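(* Let $k$ be a commutative ring, let $A$ be an associative unital $k$-algebra with an invertible element $\rho\in A\otimes A$ and an algebra anti-automorphism $s:A\to A$ such that $(A,\rho,s)$ is a quantum algebra. Then $A$ is a standard oriented quantum algebra with $t=s^{-2}$; that is, $(A,\rho,1_A,s^{-2})$ is an oriented quantum algebra with $D=1_A$ and $U=s^{-2}$. In particular, this applies to every quasitriangular ribbon Hopf algebra $A$ with universal $R$-matrix $\rho$ and antipode $s$.
   Context: **Quantum algebra.** A triple $(A,\rho,s)$ with $A$ an associative unital $k$-algebra, $\rho\in A\otimes A$ invertible satisfying the Yang-Baxter equation $\rho_{12}\rho_{13}\rho_{23}=\rho_{23}\rho_{13}\rho_{12}$ in $A^{\otimes 3}$ (where $\rho_{ij}$ has the tensor factors of $\rho$ in positions $i,j$ and $1$ elsewhere), and $s:A\to A$ a (bijective) algebra anti-automorphism, called the antipode, such that $(s\otimes s)\rho=\rho$ and $(s\otimes 1)\rho=(1\otimes s^{-1})\rho=\rho^{-1}$. **Oriented quantum algebra.** A quadruple $(A,\rho,D,U)$ with $A$ an associative unital $k$-algebra, $\rho\in A\otimes A$ an invertible solution of the Yang-Baxter equation $\rho_{12}\rho_{13}\rho_{23}=\rho_{23}\rho_{13}\rho_{12}$ in $A^{\otimes 3}$, and $U,D:A\to A$ commuting algebra automorphisms such that $(U\otimes U)\rho=\rho$, $(D\otimes D)\rho=\rho$, and $$[(1_A\otimes U)\rho]\,[(D\otimes 1_{A^{op}})\rho^{-1}]=1_{A\otimes A^{op}}=[(D\otimes 1_{A^{op}})\rho^{-1}]\,[(1_A\otimes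 U)\rho]$$ where the products are taken in $A\otimes A^{op}$, $A^{op}$ being the opposite algebra. It is called standard if $D$ is the identity map. *)

theory Defs
  imports "HOL-Algebra.Module" "HOL-Algebra.Free_Abelian_Groups"
begin

section \<open>Associative algebras over a commutative ring\<close>

text \<open>The locale \<^locale>\<open>algebra\<close> of HOL-Algebra covers commutative algebras only.\<close>

locale k_algebra = module k A + ring A
  for k :: "'k ring" and A :: "('k, 'a) module" (structure) +
  assumes smult_mult_left:
      "\<lbrakk> r \<in> carrier k; x \<in> carrier A; y \<in> carrier A \<rbrakk> \<Longrightarrow> (r \<odot> x) \<otimes> y = r \<odot> (x \<otimes> y)"
    and smult_mult_right:
      "\<lbrakk> r \<in> carrier k; x \<in> carrier A; y \<in> carrier A \<rbrakk> \<Longrightarrow> x \<otimes> (r \<odot> y) = r \<odot> (x \<otimes> y)"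

definition opposite :: "('k, 'a) module \<Rightarrow> ('k, 'a) module" where
  "opposite A = A\<lparr>mult := \<lambda>x y. y \<otimes>\<^bsub>A\<^esub> x\<rparr>"

definition algebra_hom :: "'k ring \<Rightarrow> ('k, 'a) module \<Rightarrow> ('k, 'b) module \<Rightarrow> ('a \<Rightarrow> 'b) set" where
  "algebra_hom k A B = {f \<in> ring_hom A B.
     \<forall>r \<in> carrier k. \<forall>x \<in> carrier A. f (r \<odot>\<^bsub>A\<^esub> x) = r \<odot>\<^bsub>B\<^esub> f x}"

definition algebra_auto :: "'k ring \<Rightarrow> ('k, 'a) module \<Rightarrow> ('a \<Rightarrow> 'a) set" where
  "algebra_auto k A = {f \<in> algebra_hom k A A. bij_betw f (carrier A) (carrier A)}"

definition algebra_antiauto :: "'k ring \<Rightarrow> ('k, 'a) module \<Rightarrow> ('a \<Rightarrow> 'a) set" where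
  "algebra_antiauto k A =
     {f \<in> algebra_hom k A (opposite A). bij_betw f (carrier A) (carrier A)}"


section \<open>Tensor products over a commutative ring\<close>

text \<open>The tensor product of two modules over \<open>k\<close> is the quotient of the free abelian group on
  the pairs of elements by the subgroup generated by the bilinearity relations. Its elements
  are cosets of formal sums of pairs.\<close>

definition tensor_relations ::
  "'k ring \<Rightarrow> ('k, 'a) module \<Rightarrow> ('k, 'b) module \<Rightarrow> ('a \<times> 'b \<Rightarrow>\<^sub>0 int) set" where
  "tensor_relations k A B =
     {frag_of (a \<oplus>\<^bsub>A\<^esub> a', b) - frag_of (a, b) - frag_of (a', b) | a a' b.
        a \<in> carrier A \<and> a' \<in> carrier A \<and> b \<in> carrier B}
   \<union> {frag_of (a, b \<oplus>\<^bsub>B\<^esub> b') - frag_of (a, b) - frag_of (a, b') | a b b'.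
        a \<in> carrier A \<and> b \<in> carrier B \<and> b' \<in> carrier B}
   \<union> {frag_of (r \<odot>\<^bsub>A\<^esub> a, b) - frag_of (a, r \<odot>\<^bsub>B\<^esub> b) | r a b.
        r \<in> carrier k \<and> a \<in> carrier A \<and> b \<in> carrier B}"

definition tensor_null ::
  "'k ring \<Rightarrow> ('k, 'a) module \<Rightarrow> ('k, 'b) module \<Rightarrow> ('a \<times> 'b \<Rightarrow>\<^sub>0 int) set" where
  "tensor_null k A B =
     generate (free_Abelian_group (carrier A \<times> carrier B)) (tensor_relations k A B)"

definition tensor_group ::
  "'k ring \<Rightarrow> ('k, 'a) module \<Rightarrow> ('k, 'b) module \<Rightarrow> ('a \<times> 'b \<Rightarrow>\<^sub>0 int) set monoid" where
  "tensor_group k A B = free_Abelian_group (carrier A \<times> carrier B) Mod tensor_null k A B"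

definition pure_tensor ::
  "'k ring \<Rightarrow> ('k, 'a) module \<Rightarrow> ('k, 'b) module \<Rightarrow> 'a \<Rightarrow> 'b \<Rightarrow> ('a \<times> 'b \<Rightarrow>\<^sub>0 int) set" where
  "pure_tensor k A B a b =
     tensor_null k A B #>\<^bsub>free_Abelian_group (carrier A \<times> carrier B)\<^esub> frag_of (a, b)"

text \<open>The homomorphism out of the tensor product induced by a balanced biadditive map \<open>\<beta>\<close> into
  the (multiplicatively written) abelian group \<open>G\<close>: it sends the class of the formal sum
  \<open>\<Sum> n\<^sub>i (a\<^sub>i, b\<^sub>i)\<close> to \<open>\<Prod> \<beta> a\<^sub>i b\<^sub>i ^ n\<^sub>i\<close>. For such \<open>\<beta>\<close> the image below is a
  singleton.\<close>

definition tensor_lift ::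
  "('c, 'z) monoid_scheme \<Rightarrow> ('a \<Rightarrow> 'b \<Rightarrow> 'c) \<Rightarrow> ('a \<times> 'b \<Rightarrow>\<^sub>0 int) set \<Rightarrow> 'c" where
  "tensor_lift G \<beta> X = the_elem ((\<lambda>c. finprod G
     (\<lambda>p. \<beta> (fst p) (snd p) [^]\<^bsub>G\<^esub> (Poly_Mapping.lookup c p :: int))
     (Poly_Mapping.keys c)) ` X)"

text \<open>The algebra structure is determined by \<open>(a \<otimes> b)(a' \<otimes> b') = aa' \<otimes> bb'\<close> and
  \<open>r(a \<otimes> b) = ra \<otimes> b\<close>.\<close>

definition tensor ::
  "'k ring \<Rightarrow> ('k, 'a) module \<Rightarrow> ('k, 'b) module \<Rightarrow> ('k, ('a \<times> 'b \<Rightarrow>\<^sub>0 int) set) module" where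
  "tensor k A B =
     \<lparr>carrier = carrier (tensor_group k A B),
      mult = (\<lambda>X Y. tensor_lift (tensor_group k A B)
        (\<lambda>a b. tensor_lift (tensor_group k A B)
          (\<lambda>a' b'. pure_tensor k A B (a \<otimes>\<^bsub>A\<^esub> a') (b \<otimes>\<^bsub>B\<^esub> b')) Y) X),
      one = pure_tensor k A B \<one>\<^bsub>A\<^esub> \<one>\<^bsub>B\<^esub>,
      ring.zero = \<one>\<^bsub>tensor_group k A B\<^esub>,
      add = monoid.mult (tensor_group k A B),
      smult = (\<lambda>r. tensor_lift (tensor_group k A B) (\<lambda>a b. pure_tensor k A B (r \<odot>\<^bsub>A\<^esub> a) b))\<rparr>"

text \<open>For linear \<open>f : A \<rightarrow> C\<close> and \<open>g : B \<rightarrow> D\<close>, the map \<open>f \<otimes> g : A \<otimes> B \<rightarrow> C \<otimes> D\<close>; only the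
  target has to be named.\<close>

definition tensor_map :: "'k ring \<Rightarrow> ('k, 'c) module \<Rightarrow> ('k, 'd) module \<Rightarrow> ('a \<Rightarrow> 'c) \<Rightarrow> ('b \<Rightarrow> 'd) \<Rightarrow>
    ('a \<times> 'b \<Rightarrow>\<^sub>0 int) set \<Rightarrow> ('c \<times> 'd \<Rightarrow>\<^sub>0 int) set" where
  "tensor_map k C D f g = tensor_lift (tensor_group k C D) (\<lambda>a b. pure_tensor k C D (f a) (g b))"

definition tensor_flip :: "'k ring \<Rightarrow> ('k, 'a) module \<Rightarrow> ('k, 'b) module \<Rightarrow>
    ('a \<times> 'b \<Rightarrow>\<^sub>0 int) set \<Rightarrow> ('b \<times> 'a \<Rightarrow>\<^sub>0 int) set" where
  "tensor_flip k A B = tensor_lift (tensor_group k B A) (\<lambda>a b. pure_tensor k B A b a)"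

text \<open>The canonical map \<open>(A \<otimes> B) \<otimes> C \<rightarrow> A \<otimes> (B \<otimes> C)\<close>.\<close>

definition tensor_assoc :: "'k ring \<Rightarrow> ('k, 'a) module \<Rightarrow> ('k, 'b) module \<Rightarrow> ('k, 'c) module \<Rightarrow>
    (('a \<times> 'b \<Rightarrow>\<^sub>0 int) set \<times> 'c \<Rightarrow>\<^sub>0 int) set \<Rightarrow>
    ('a \<times> ('b \<times> 'c \<Rightarrow>\<^sub>0 int) set \<Rightarrow>\<^sub>0 int) set" where
  "tensor_assoc k A B C =
     tensor_lift (tensor_group k A (tensor k B C))
       (\<lambda>X c. tensor_lift (tensor_group k A (tensor k B C))
         (\<lambda>a b. pure_tensor k A (tensor k B C) a (pure_tensor k B C b c)) X)"


section \<open>The Yang-Baxter equation\<close>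

text \<open>The threefold tensor power is \<open>(A \<otimes> A) \<otimes> A\<close>.\<close>

abbreviation tensor2 :: "'k ring \<Rightarrow> ('k, 'a) module \<Rightarrow> _" where
  "tensor2 k A \<equiv> tensor k A A"

abbreviation tensor3 :: "'k ring \<Rightarrow> ('k, 'a) module \<Rightarrow> _" where
  "tensor3 k A \<equiv> tensor k (tensor k A A) A"

definition place12 where
  "place12 k A \<rho> = pure_tensor k (tensor2 k A) A \<rho> \<one>\<^bsub>A\<^esub>"

definition place13 where
  "place13 k A = tensor_map k (tensor2 k A) A (\<lambda>a. pure_tensor k A A a \<one>\<^bsub>A\<^esub>) (\<lambda>b. b)"

definition place23 where
  "place23 k A = tensor_map k (tensor2 k A) A (\<lambda>a. pure_tensor k A A \<one>\<^bsub>A\<^esub> a) (\<lambda>b. b)"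

definition yang_baxter ::
  "'k ring \<Rightarrow> ('k, 'a) module \<Rightarrow> ('a \<times> 'a \<Rightarrow>\<^sub>0 int) set \<Rightarrow> bool" where
  "yang_baxter k A \<rho> \<longleftrightarrow>
     place12 k A \<rho> \<otimes>\<^bsub>tensor3 k A\<^esub> place13 k A \<rho> \<otimes>\<^bsub>tensor3 k A\<^esub> place23 k A \<rho> =
     place23 k A \<rho> \<otimes>\<^bsub>tensor3 k A\<^esub> place13 k A \<rho> \<otimes>\<^bsub>tensor3 k A\<^esub> place12 k A \<rho>"


section \<open>Quantum algebras and oriented quantum algebras\<close>

abbreviation inv_on :: "('k, 'a) module \<Rightarrow> ('a \<Rightarrow> 'a) \<Rightarrow> 'a \<Rightarrow> 'a" where
  "inv_on A s \<equiv> inv_into (carrier A) s"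

locale quantum_algebra = k_algebra k A for k :: "'k ring" and A :: "('k, 'a) module" +
  fixes \<rho> :: "('a \<times> 'a \<Rightarrow>\<^sub>0 int) set" and s :: "'a \<Rightarrow> 'a"
  assumes rho_invertible: "\<rho> \<in> Units (tensor2 k A)"
    and rho_yang_baxter: "yang_baxter k A \<rho>"
    and antipode: "s \<in> algebra_antiauto k A"
    and antipode_antipode_rho: "tensor_map k A A s s \<rho> = \<rho>"
    and antipode_left_rho: "tensor_map k A A s id \<rho> = inv\<^bsub>tensor2 k A\<^esub> \<rho>"
    and antipode_right_rho: "tensor_map k A A id (inv_on A s) \<rho> = inv\<^bsub>tensor2 k A\<^esub> \<rho>"

text \<open>The modules underlying \<open>A \<otimes> A\<close> and \<open>A \<otimes> A\<^sup>o\<^sup>p\<close> coincide, so that elements of the former may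
  be multiplied in the latter.\<close>

locale oriented_quantum_algebra = k_algebra k A for k :: "'k ring" and A :: "('k, 'a) module" +
  fixes \<rho> :: "('a \<times> 'a \<Rightarrow>\<^sub>0 int) set" and D U :: "'a \<Rightarrow> 'a"
  assumes rho_invertible: "\<rho> \<in> Units (tensor2 k A)"
    and rho_yang_baxter: "yang_baxter k A \<rho>"
    and U_auto: "U \<in> algebra_auto k A"
    and D_auto: "D \<in> algebra_auto k A"
    and U_D_commute: "x \<in> carrier A \<Longrightarrow> U (D x) = D (U x)"
    and U_U_rho: "tensor_map k A A U U \<rho> = \<rho>"
    and D_D_rho: "tensor_map k A A D D \<rho> = \<rho>"
    and U_D_inverse:
      "tensor_map k A (opposite A) id U \<rho> \<otimes>\<^bsub>tensor k A (opposite A)\<^esub>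
         tensor_map k A (opposite A) D id (inv\<^bsub>tensor2 k A\<^esub> \<rho>) = \<one>\<^bsub>tensor k A (opposite A)\<^esub>"
    and D_U_inverse:
      "tensor_map k A (opposite A) D id (inv\<^bsub>tensor2 k A\<^esub> \<rho>) \<otimes>\<^bsub>tensor k A (opposite A)\<^esub>
         tensor_map k A (opposite A) id U \<rho> = \<one>\<^bsub>tensor k A (opposite A)\<^esub>"

locale standard_oriented_quantum_algebra = oriented_quantum_algebra k A \<rho> D U
  for k :: "'k ring" and A :: "('k, 'a) module" and \<rho> and D and U +
  assumes D_identity: "x \<in> carrier A \<Longrightarrow> D x = x"


section \<open>Quasitriangular ribbon Hopf algebras\<close>

locale hopf_algebra = k_algebra k A for k :: "'k ring" and A :: "('k, 'a) module" +
  fixes \<Delta> :: "'a \<Rightarrow> ('a \<times> 'a \<Rightarrow>\<^sub>0 int) set" and \<epsilon> :: "'a \<Rightarrow> 'k" and s :: "'a \<Rightarrow> 'a"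
  assumes comult_hom: "\<Delta> \<in> algebra_hom k A (tensor2 k A)"
    and counit_hom: "\<epsilon> \<in> ring_hom A k"
    and counit_linear:
      "\<lbrakk> r \<in> carrier k; x \<in> carrier A \<rbrakk> \<Longrightarrow> \<epsilon> (r \<odot>\<^bsub>A\<^esub> x) = r \<otimes>\<^bsub>k\<^esub> \<epsilon> x"
    and coassoc: "x \<in> carrier A \<Longrightarrow>
      tensor_assoc k A A A (tensor_map k (tensor2 k A) A \<Delta> id (\<Delta> x)) =
      tensor_map k A (tensor2 k A) id \<Delta> (\<Delta> x)"
    and counit_left: "x \<in> carrier A \<Longrightarrow>
      tensor_lift (add_monoid A) (\<lambda>a b. \<epsilon> a \<odot>\<^bsub>A\<^esub> b) (\<Delta> x) = x"
    and counit_right: "x \<in> carrier A \<Longrightarrow>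
      tensor_lift (add_monoid A) (\<lambda>a b. \<epsilon> b \<odot>\<^bsub>A\<^esub> a) (\<Delta> x) = x"
    and antipode_closed: "s \<in> carrier A \<rightarrow> carrier A"
    and antipode_add:
      "\<lbrakk> x \<in> carrier A; y \<in> carrier A \<rbrakk> \<Longrightarrow> s (x \<oplus>\<^bsub>A\<^esub> y) = s x \<oplus>\<^bsub>A\<^esub> s y"
    and antipode_smult:
      "\<lbrakk> r \<in> carrier k; x \<in> carrier A \<rbrakk> \<Longrightarrow> s (r \<odot>\<^bsub>A\<^esub> x) = r \<odot>\<^bsub>A\<^esub> s x"
    and antipode_left: "x \<in> carrier A \<Longrightarrow>
      tensor_lift (add_monoid A) (\<lambda>a b. s a \<otimes>\<^bsub>A\<^esub> b) (\<Delta> x) = \<epsilon> x \<odot>\<^bsub>A\<^esub> \<one>\<^bsub>A\<^esub>"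
    and antipode_right: "x \<in> carrier A \<Longrightarrow>
      tensor_lift (add_monoid A) (\<lambda>a b. a \<otimes>\<^bsub>A\<^esub> s b) (\<Delta> x) = \<epsilon> x \<odot>\<^bsub>A\<^esub> \<one>\<^bsub>A\<^esub>"

locale quasitriangular_hopf_algebra = hopf_algebra k A \<Delta> \<epsilon> s
  for k :: "'k ring" and A :: "('k, 'a) module" and \<Delta> and \<epsilon> and s +
  fixes R :: "('a \<times> 'a \<Rightarrow>\<^sub>0 int) set"
  assumes R_invertible: "R \<in> Units (tensor2 k A)"
    and R_comult: "x \<in> carrier A \<Longrightarrow>
      tensor_flip k A A (\<Delta> x) \<otimes>\<^bsub>tensor2 k A\<^esub> R = R \<otimes>\<^bsub>tensor2 k A\<^esub> \<Delta> x"
    and R_comult_left: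
      "tensor_map k (tensor2 k A) A \<Delta> id R = place13 k A R \<otimes>\<^bsub>tensor3 k A\<^esub> place23 k A R"
    and R_comult_right:
      "tensor_map k A (tensor2 k A) id \<Delta> R =
       tensor_assoc k A A A (place13 k A R \<otimes>\<^bsub>tensor3 k A\<^esub> place12 k A R)"

text \<open>The Drinfeld element \<open>u = \<Sum> s(b\<^sub>i) a\<^sub>i\<close> of \<open>R = \<Sum> a\<^sub>i \<otimes> b\<^sub>i\<close>.\<close>

definition drinfeld_element ::
  "('k, 'a) module \<Rightarrow> ('a \<Rightarrow> 'a) \<Rightarrow> ('a \<times> 'a \<Rightarrow>\<^sub>0 int) set \<Rightarrow> 'a" where
  "drinfeld_element A s R = tensor_lift (add_monoid A) (\<lambda>a b. s b \<otimes>\<^bsub>A\<^esub> a) R"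

text \<open>A ribbon element \<open>v\<close> in the sense of Reshetikhin and Turaev; it is automatically
  invertible.\<close>

locale ribbon_hopf_algebra = quasitriangular_hopf_algebra k A \<Delta> \<epsilon> s R
  for k :: "'k ring" and A :: "('k, 'a) module" and \<Delta> and \<epsilon> and s and R +
  fixes v :: 'a
  assumes ribbon_closed: "v \<in> carrier A"
    and ribbon_central: "x \<in> carrier A \<Longrightarrow> v \<otimes>\<^bsub>A\<^esub> x = x \<otimes>\<^bsub>A\<^esub> v"
    and ribbon_square:
      "v \<otimes>\<^bsub>A\<^esub> v = drinfeld_element A s R \<otimes>\<^bsub>A\<^esub> s (drinfeld_element A s R)"
    and ribbon_antipode: "s v = v"
    and ribbon_counit: "\<epsilon> v = \<one>\<^bsub>k\<^esub>"
    and ribbon_comult: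
      "\<Delta> v = inv\<^bsub>tensor2 k A\<^esub> (tensor_flip k A A R \<otimes>\<^bsub>tensor2 k A\<^esub> R)
             \<otimes>\<^bsub>tensor2 k A\<^esub> pure_tensor k A A v v"

end

theory Submission
  imports Defs
begin

text \<open>
  In the first part put \<open>t = s\<inverse>\<close>. An anti-automorphism is a homomorphism \<open>A \<rightarrow> A\<^sup>o\<^sup>p\<close>, so
  \<open>\<phi> = 1 \<otimes> t\<close> is a homomorphism of algebras \<open>A \<otimes> A \<rightarrow> A \<otimes> A\<^sup>o\<^sup>p\<close>. The axiom
  \<open>(1 \<otimes> t)\<rho> = \<rho>\<inverse>\<close> says \<open>\<phi>(\<rho>) = \<rho>\<inverse>\<close>, whence \<open>\<phi>(\<rho>\<inverse>) = (1 \<otimes> t\<^sup>2)\<rho>\<close>. Applying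
  \<open>\<phi>\<close> to \<open>\<rho>\<rho>\<inverse> = 1 = \<rho>\<inverse>\<rho>\<close> gives the two identities in \<open>A \<otimes> A\<^sup>o\<^sup>p\<close> that an oriented quantum
  algebra with \<open>D = 1\<close> and \<open>U = t\<^sup>2\<close> has to satisfy (\<open>standard_oriented\<close>).

  The second part is the theory of quasitriangular Hopf algebras, from the Hopf axioms up to the
  axioms of a quantum algebra (\<open>quantum\<close>).
  \<^item> That \<open>s\<close> reverses products (\<open>antipode_mult\<close>) is the uniqueness of convolution inverses, here in
    the form \<open>\<Sum> s(x\<^sub>1 y) x\<^sub>2 = \<epsilon>(x) s(y)\<close>.
  \<^item> The Yang-Baxter equation (\<open>yang_baxter_R\<close>) results from \<open>R \<Delta> = \<Delta>\<^sup>o\<^sup>p R\<close> in the first two tensor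
    factors, applied to \<open>(\<Delta> \<otimes> 1)R = R\<^sub>1\<^sub>3R\<^sub>2\<^sub>3\<close>.
  \<^item> Contracting the two formulas for \<open>(\<Delta> \<otimes> 1)R\<close> and \<open>(1 \<otimes> \<Delta>)R\<close> with the counit yields
    \<open>(\<epsilon> \<otimes> 1)R = 1 = (1 \<otimes> \<epsilon>)R\<close>; contracting them with \<open>a \<otimes> b \<mapsto> s(a)b\<close> then yields
    \<open>(s \<otimes> 1)R = R\<inverse>\<close> and \<open>(1 \<otimes> s)R\<inverse> = R\<close>.
  \<^item> Drinfeld's element \<open>u = \<Sum> s(b\<^sub>i) a\<^sub>i\<close> satisfies \<open>s\<^sup>2(x)u = ux\<close> and is invertible. Hence \<open>s\<^sup>2\<close> is an
    inner automorphism and \<open>s\<close> is bijective, which is part of the definition of a quantum algebra but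
    not of the definition of a Hopf algebra.

  Sums over the components of a tensor are never chosen explicitly. An expression such as
  \<open>\<Sum> \<beta>(x\<^sub>1, x\<^sub>2)\<close> is the value at \<open>\<Delta>(x)\<close> of the linear map induced by the bilinear map \<open>\<beta>\<close>, and two
  linear maps out of a tensor product are equal once they agree on pure tensors. This turns every
  computation with components into one with pure tensors, for which linearity in each variable is
  decided by the syntax of the expression.
\<close>

section \<open>Linear and bilinear maps\<close>

text \<open>Linear maps out of a tensor product come from bilinear maps. Balanced maps, whose values need only
  lie in an abelian group, are nevertheless needed at the start: scalar multiplication on the tensor
  product is itself induced by such a map, before its target is known to be a module.\<close>

definition balanced ::
  "'k ring \<Rightarrow> ('k, 'a) module \<Rightarrow> ('k, 'b) module \<Rightarrow> ('c, 'm) ring_scheme \<Rightarrow> ('a \<Rightarrow> 'b \<Rightarrow> 'c) \<Rightarrow> bool" where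
  "balanced k A B M \<beta> \<longleftrightarrow>
     (\<forall>a\<in>carrier A. \<forall>b\<in>carrier B. \<beta> a b \<in> carrier M) \<and>
     (\<forall>a\<in>carrier A. \<forall>a'\<in>carrier A. \<forall>b\<in>carrier B. \<beta> (a \<oplus>\<^bsub>A\<^esub> a') b = \<beta> a b \<oplus>\<^bsub>M\<^esub> \<beta> a' b) \<and>
     (\<forall>a\<in>carrier A. \<forall>b\<in>carrier B. \<forall>b'\<in>carrier B. \<beta> a (b \<oplus>\<^bsub>B\<^esub> b') = \<beta> a b \<oplus>\<^bsub>M\<^esub> \<beta> a b') \<and>
     (\<forall>r\<in>carrier k. \<forall>a\<in>carrier A. \<forall>b\<in>carrier B. \<beta> (r \<odot>\<^bsub>A\<^esub> a) b = \<beta> a (r \<odot>\<^bsub>B\<^esub> b))"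

definition linear_map :: "'k ring \<Rightarrow> ('k, 'a) module \<Rightarrow> ('k, 'b) module \<Rightarrow> ('a \<Rightarrow> 'b) \<Rightarrow> bool" where
  "linear_map k A B f \<longleftrightarrow>
     (\<forall>x\<in>carrier A. f x \<in> carrier B) \<and>
     (\<forall>x\<in>carrier A. \<forall>y\<in>carrier A. f (x \<oplus>\<^bsub>A\<^esub> y) = f x \<oplus>\<^bsub>B\<^esub> f y) \<and>
     (\<forall>r\<in>carrier k. \<forall>x\<in>carrier A. f (r \<odot>\<^bsub>A\<^esub> x) = r \<odot>\<^bsub>B\<^esub> f x)"

definition bilinear_map ::
  "'k ring \<Rightarrow> ('k, 'a) module \<Rightarrow> ('k, 'b) module \<Rightarrow> ('k, 'c) module \<Rightarrow> ('a \<Rightarrow> 'b \<Rightarrow> 'c) \<Rightarrow> bool" where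
  "bilinear_map k A B M \<beta> \<longleftrightarrow>
     (\<forall>b\<in>carrier B. linear_map k A M (\<lambda>a. \<beta> a b)) \<and>
     (\<forall>a\<in>carrier A. linear_map k B M (\<lambda>b. \<beta> a b))"

lemma linear_mapI:
  assumes "\<And>x. x \<in> carrier A \<Longrightarrow> f x \<in> carrier B"
    and "\<And>x y. x \<in> carrier A \<Longrightarrow> y \<in> carrier A \<Longrightarrow> f (x \<oplus>\<^bsub>A\<^esub> y) = f x \<oplus>\<^bsub>B\<^esub> f y"
    and "\<And>r x. r \<in> carrier k \<Longrightarrow> x \<in> carrier A \<Longrightarrow> f (r \<odot>\<^bsub>A\<^esub> x) = r \<odot>\<^bsub>B\<^esub> f x"
  shows "linear_map k A B f"
  using assms by (auto simp: linear_map_def)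

lemma linear_map_closed: "linear_map k A B f \<Longrightarrow> x \<in> carrier A \<Longrightarrow> f x \<in> carrier B"
  and linear_map_add: "linear_map k A B f \<Longrightarrow> x \<in> carrier A \<Longrightarrow> y \<in> carrier A \<Longrightarrow>
    f (x \<oplus>\<^bsub>A\<^esub> y) = f x \<oplus>\<^bsub>B\<^esub> f y"
  and linear_map_smult: "linear_map k A B f \<Longrightarrow> r \<in> carrier k \<Longrightarrow> x \<in> carrier A \<Longrightarrow>
    f (r \<odot>\<^bsub>A\<^esub> x) = r \<odot>\<^bsub>B\<^esub> f x"
  by (auto simp: linear_map_def)

lemma linear_map_cong:
  assumes "linear_map k A B f" "module k A" "\<And>x. x \<in> carrier A \<Longrightarrow> g x = f x"
  shows "linear_map k A B g"
proof -
  interpret A: module k A by fact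
  show ?thesis
    using assms(1,3) by (simp add: linear_map_def)
qed

lemma linear_map_comp: "linear_map k B C g \<Longrightarrow> linear_map k A B f \<Longrightarrow> linear_map k A C (\<lambda>x. g (f x))"
  by (simp add: linear_map_def)

lemma linear_map_ident: "linear_map k A A (\<lambda>x. x)"
  by (simp add: linear_map_def)

lemma bilinear_mapI:
  assumes "\<And>b. b \<in> carrier B \<Longrightarrow> linear_map k A M (\<lambda>a. \<beta> a b)"
    and "\<And>a. a \<in> carrier A \<Longrightarrow> linear_map k B M (\<lambda>b. \<beta> a b)"
  shows "bilinear_map k A B M \<beta>"
  using assms by (auto simp: bilinear_map_def)

lemma bilinear_map_left: "bilinear_map k A B M \<beta> \<Longrightarrow> b \<in> carrier B \<Longrightarrow> linear_map k A M (\<lambda>a. \<beta> a b)"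
  and bilinear_map_right: "bilinear_map k A B M \<beta> \<Longrightarrow> a \<in> carrier A \<Longrightarrow> linear_map k B M (\<lambda>b. \<beta> a b)"
  by (auto simp: bilinear_map_def)

lemma bilinear_map_balanced: "bilinear_map k A B M \<beta> \<Longrightarrow> balanced k A B M \<beta>"
  by (simp add: bilinear_map_def linear_map_def balanced_def)


section \<open>Tensor products of modules\<close>

abbreviation tensor_hom :: "('c, 'm) ring_scheme \<Rightarrow> ('a \<Rightarrow> 'b \<Rightarrow> 'c) \<Rightarrow> ('a \<times> 'b \<Rightarrow>\<^sub>0 int) set \<Rightarrow> 'c" where
  "tensor_hom M \<equiv> tensor_lift (add_monoid M)"

text \<open>The group operations of the tensor product occur in two guises, as a quotient group and as the additive
  group of a module. The induced map does not see the difference, and everything below uses the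
  second guise.\<close>

lemma tensor_lift_group_cong:
  assumes "carrier G = carrier H" "monoid.mult G = monoid.mult H" "\<one>\<^bsub>G\<^esub> = \<one>\<^bsub>H\<^esub>"
  shows "tensor_lift G \<beta> = tensor_lift H \<beta>"
  unfolding tensor_lift_def finprod_def int_pow_def nat_pow_def m_inv_def assms by (rule refl)

lemma tensor_lift_group:
  "tensor_lift (tensor_group k A B) \<beta> = tensor_hom (tensor k A B) \<beta>"
  by (rule tensor_lift_group_cong) (simp_all add: tensor_def)

lemma tensor_map_hom:
  "tensor_map k C D f g = tensor_hom (tensor k C D) (\<lambda>a b. pure_tensor k C D (f a) (g b))"
  by (simp add: tensor_map_def tensor_lift_group)

lemma carrier_tensor_group: "carrier (tensor_group k A B) = carrier (tensor k A B)"
  and mult_tensor_group: "monoid.mult (tensor_group k A B) = add (tensor k A B)"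
  and one_tensor_group: "\<one>\<^bsub>tensor_group k A B\<^esub> = \<zero>\<^bsub>tensor k A B\<^esub>"
  by (simp_all add: tensor_def)

definition formal_sum :: "('c, 'z) monoid_scheme \<Rightarrow> ('a \<Rightarrow> 'b \<Rightarrow> 'c) \<Rightarrow> ('a \<times> 'b \<Rightarrow>\<^sub>0 int) \<Rightarrow> 'c" where
  "formal_sum G \<beta> c = finprod G (\<lambda>p. \<beta> (fst p) (snd p) [^]\<^bsub>G\<^esub> (Poly_Mapping.lookup c p :: int))
     (Poly_Mapping.keys c)"

text \<open>Two formal sums are added by extending both to the union of their supports.\<close>

lemma (in comm_group) formal_sum_superset:
  assumes \<beta>: "\<And>p. p \<in> K \<Longrightarrow> \<beta> (fst p) (snd p) \<in> carrier G"
    and K: "finite K" "Poly_Mapping.keys c \<subseteq> K"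
  shows "formal_sum G \<beta> c = finprod G (\<lambda>p. \<beta> (fst p) (snd p) [^] (Poly_Mapping.lookup c p :: int)) K"
  unfolding formal_sum_def
  by (rule finprod_mono_neutral_cong_left) (use K \<beta> in \<open>auto simp: in_keys_iff\<close>)

lemma (in comm_group) formal_sum_hom:
  assumes \<beta>: "\<And>a b. (a, b) \<in> S \<Longrightarrow> \<beta> a b \<in> carrier G"
  shows "formal_sum G \<beta> \<in> hom (free_Abelian_group S) G"
proof (rule homI)
  have closed: "\<beta> (fst p) (snd p) \<in> carrier G" if "p \<in> S" for p
    using \<beta> that by (cases p) auto
  show "formal_sum G \<beta> x \<in> carrier G" if "x \<in> carrier (free_Abelian_group S)" for x
    using that closed by (auto simp: formal_sum_def intro!: finprod_closed)
  fix x y assume "x \<in> carrier (free_Abelian_group S)" "y \<in> carrier (free_Abelian_group S)"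
  then have xy: "Poly_Mapping.keys x \<subseteq> S" "Poly_Mapping.keys y \<subseteq> S" by auto
  define K where "K = Poly_Mapping.keys x \<union> Poly_Mapping.keys y"
  have K: "finite K" "Poly_Mapping.keys x \<subseteq> K" "Poly_Mapping.keys y \<subseteq> K"
    "Poly_Mapping.keys (x + y) \<subseteq> K"
    using keys_add[of x y] by (auto simp: K_def)
  have \<beta>K: "\<beta> (fst p) (snd p) \<in> carrier G" if "p \<in> K" for p
    using closed xy that by (auto simp: K_def)
  note sum = formal_sum_superset[of K \<beta>, OF \<beta>K K(1), simplified]
  show "formal_sum G \<beta> (x \<otimes>\<^bsub>free_Abelian_group S\<^esub> y) = formal_sum G \<beta> x \<otimes> formal_sum G \<beta> y"
    unfolding mult_free_Abelian_group sum[OF K(2)] sum[OF K(3)] sum[OF K(4)]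
  proof -
    let ?f = "\<lambda>c p. \<beta> (fst p) (snd p) [^] (Poly_Mapping.lookup c p :: int)"
    have "finprod G (?f (x + y)) K = finprod G (\<lambda>p. ?f x p \<otimes> ?f y p) K"
      by (rule finprod_cong') (use \<beta>K in \<open>auto simp: lookup_add int_pow_mult\<close>)
    also have "\<dots> = finprod G (?f x) K \<otimes> finprod G (?f y) K"
      by (rule finprod_multf) (use \<beta>K in auto)
    finally show "finprod G (?f (x + y)) K = finprod G (?f x) K \<otimes> finprod G (?f y) K" .
  qed
qed

lemma (in comm_group) formal_sum_frag_of:
  assumes "\<beta> a b \<in> carrier G"
  shows "formal_sum G \<beta> (frag_of (a, b)) = \<beta> a b"
  using assms by (simp add: formal_sum_def int_pow_1)

lemma tensor_lift_formal_sum: "tensor_lift G \<beta> X = the_elem (formal_sum G \<beta> ` X)"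
  by (simp add: tensor_lift_def formal_sum_def)

locale module_pair = A: module k A + B: module k B
  for k :: "'k ring" and A :: "('k, 'a) module" and B :: "('k, 'b) module"
begin

abbreviation (input) F where "F \<equiv> free_Abelian_group (carrier A \<times> carrier B)"
abbreviation (input) N where "N \<equiv> tensor_null k A B"
abbreviation (input) T where "T \<equiv> tensor k A B"
abbreviation (input) coset where "coset c \<equiv> N #>\<^bsub>F\<^esub> c"

sublocale F: comm_group F
  by (rule abelian_free_Abelian_group)

lemma tensor_relations_closed: "tensor_relations k A B \<subseteq> carrier F"
  by (auto simp: tensor_relations_def dest!: subsetD[OF keys_diff])

sublocale N: normal N F
  unfolding tensor_null_def
  by (rule F.subgroup_imp_normal, rule F.generate_is_subgroup, rule tensor_relations_closed)

lemma carrier_tensor: "carrier T = {coset c | c. c \<in> carrier F}"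
  by (auto simp: tensor_def tensor_group_def carrier_FactGroup)

lemma coset_closed: "c \<in> carrier F \<Longrightarrow> coset c \<in> carrier T"
  by (auto simp: carrier_tensor)

lemma coset_add: "c \<in> carrier F \<Longrightarrow> d \<in> carrier F \<Longrightarrow> coset (c + d) = coset c \<oplus>\<^bsub>T\<^esub> coset d"
  using N.rcos_sum[of c d] by (simp add: tensor_def tensor_group_def)

lemma coset_eqI:
  assumes "c \<in> carrier F" "d \<in> carrier F" "c - d \<in> N"
  shows "coset c = coset d"
proof -
  have "c \<in> coset d"
    using assms N.rcos_module[of d c] F.is_group by simp
  then show ?thesis
    using F.repr_independence[of c N d] assms N.subgroup_axioms by simp
qed

lemma pure_tensor_coset: "pure_tensor k A B a b = coset (frag_of (a, b))"
  by (simp add: pure_tensor_def)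

lemma pure_closed [simp]:
  "a \<in> carrier A \<Longrightarrow> b \<in> carrier B \<Longrightarrow> pure_tensor k A B a b \<in> carrier T"
  by (simp add: pure_tensor_coset coset_closed)

lemma relation_null: "c \<in> tensor_relations k A B \<Longrightarrow> c \<in> N"
  by (simp add: tensor_null_def generate.incl)

lemma pure_add_left:
  assumes "a \<in> carrier A" "a' \<in> carrier A" "b \<in> carrier B"
  shows "pure_tensor k A B (a \<oplus>\<^bsub>A\<^esub> a') b = pure_tensor k A B a b \<oplus>\<^bsub>T\<^esub> pure_tensor k A B a' b"
proof -
  have "frag_of (a \<oplus>\<^bsub>A\<^esub> a', b) - frag_of (a, b) - frag_of (a', b) \<in> N"
    by (rule relation_null) (use assms in \<open>auto simp: tensor_relations_def\<close>)
  then have "coset (frag_of (a \<oplus>\<^bsub>A\<^esub> a', b)) = coset (frag_of (a, b) + frag_of (a', b))"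
    by (intro coset_eqI) (use assms in \<open>auto simp: algebra_simps dest!: subsetD[OF keys_add]\<close>)
  then show ?thesis
    using assms by (simp add: pure_tensor_coset coset_add)
qed

lemma pure_add_right:
  assumes "a \<in> carrier A" "b \<in> carrier B" "b' \<in> carrier B"
  shows "pure_tensor k A B a (b \<oplus>\<^bsub>B\<^esub> b') = pure_tensor k A B a b \<oplus>\<^bsub>T\<^esub> pure_tensor k A B a b'"
proof -
  have "frag_of (a, b \<oplus>\<^bsub>B\<^esub> b') - frag_of (a, b) - frag_of (a, b') \<in> N"
    by (rule relation_null) (use assms in \<open>auto simp: tensor_relations_def\<close>)
  then have "coset (frag_of (a, b \<oplus>\<^bsub>B\<^esub> b')) = coset (frag_of (a, b) + frag_of (a, b'))"
    by (intro coset_eqI) (use assms in \<open>auto simp: algebra_simps dest!: subsetD[OF keys_add]\<close>)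
  then show ?thesis
    using assms by (simp add: pure_tensor_coset coset_add)
qed

lemma pure_smult_left_right:
  assumes "r \<in> carrier k" "a \<in> carrier A" "b \<in> carrier B"
  shows "pure_tensor k A B (r \<odot>\<^bsub>A\<^esub> a) b = pure_tensor k A B a (r \<odot>\<^bsub>B\<^esub> b)"
proof -
  have "frag_of (r \<odot>\<^bsub>A\<^esub> a, b) - frag_of (a, r \<odot>\<^bsub>B\<^esub> b) \<in> N"
    by (rule relation_null) (use assms in \<open>auto simp: tensor_relations_def\<close>)
  then show ?thesis
    using assms unfolding pure_tensor_coset by (intro coset_eqI) auto
qed

lemma tensor_comm_group: "comm_group (tensor_group k A B)"
  unfolding tensor_group_def
  by (rule F.abelian_FactGroup, rule N.subgroup_axioms)

lemma tensor_abelian_group: "abelian_group T"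
proof -
  interpret G: comm_group "tensor_group k A B" by (rule tensor_comm_group)
  have inv: "\<exists>y\<in>carrier T. y \<oplus>\<^bsub>T\<^esub> x = \<zero>\<^bsub>T\<^esub>" if "x \<in> carrier T" for x
    using that G.l_inv_ex[of x]
    by (simp add: carrier_tensor_group mult_tensor_group one_tensor_group)
  show ?thesis
    by (rule abelian_groupI)
      (use inv G.m_assoc G.m_comm G.l_one G.m_closed G.one_closed in
        \<open>simp_all add: carrier_tensor_group mult_tensor_group one_tensor_group\<close>)
qed

sublocale T: abelian_group T
  by (rule tensor_abelian_group)

lemma coset_zero: "coset 0 = \<zero>\<^bsub>T\<^esub>"
proof -
  have "coset 0 \<oplus>\<^bsub>T\<^esub> coset 0 = coset 0"
    using coset_add[of 0 0] by simp
  then show ?thesis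
    using T.add.l_cancel_one[of "coset 0" "coset 0"] coset_closed[of 0] by simp
qed

lemma pure_zero_left: "b \<in> carrier B \<Longrightarrow> pure_tensor k A B \<zero>\<^bsub>A\<^esub> b = \<zero>\<^bsub>T\<^esub>"
  using pure_add_left[of "\<zero>\<^bsub>A\<^esub>" "\<zero>\<^bsub>A\<^esub>" b] T.add.l_cancel_one[of "pure_tensor k A B \<zero>\<^bsub>A\<^esub> b" "pure_tensor k A B \<zero>\<^bsub>A\<^esub> b"]
  by simp

lemma coset_uminus: "c \<in> carrier F \<Longrightarrow> coset (- c) = \<ominus>\<^bsub>T\<^esub> coset c"
  using coset_add[of "- c" c] coset_closed[of c] coset_closed[of "- c"] coset_zero
  by (metis T.minus_equality add.left_inverse carrier_free_Abelian_group_iff keys_minus)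

lemma pure_uminus_left:
  assumes "a \<in> carrier A" "b \<in> carrier B"
  shows "pure_tensor k A B (\<ominus>\<^bsub>A\<^esub> a) b = \<ominus>\<^bsub>T\<^esub> pure_tensor k A B a b"
  using pure_add_left[of "\<ominus>\<^bsub>A\<^esub> a" a b] assms
  by (intro T.minus_equality[symmetric]) (auto simp: A.M.l_neg pure_zero_left)

text \<open>Negatives of pure tensors are pure, so the pure tensors generate under addition alone and neither
  zero nor negation needs a case.\<close>

lemma tensor_induct [consumes 1, case_names pure add]:
  assumes X: "X \<in> carrier T"
    and pure: "\<And>a b. a \<in> carrier A \<Longrightarrow> b \<in> carrier B \<Longrightarrow> P (pure_tensor k A B a b)"
    and add: "\<And>X Y. X \<in> carrier T \<Longrightarrow> Y \<in> carrier T \<Longrightarrow> P X \<Longrightarrow> P Y \<Longrightarrow> P (X \<oplus>\<^bsub>T\<^esub> Y)"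
  shows "P X"
proof -
  obtain c where c: "X = coset c" "Poly_Mapping.keys c \<subseteq> carrier A \<times> carrier B"
    using X by (auto simp: carrier_tensor)
  from c(2) have "P (coset c) \<and> P (coset (- c))"
  proof (induction c rule: free_Abelian_group_induct[consumes 1, case_names zero diff frag])
    case zero
    show ?case
      using pure[of "\<zero>\<^bsub>A\<^esub>" "\<zero>\<^bsub>B\<^esub>"] by (simp add: pure_zero_left coset_zero)
  next
    case (diff x y)
    have "coset (x + - y) = coset x \<oplus>\<^bsub>T\<^esub> coset (- y)" "coset (- x + y) = coset (- x) \<oplus>\<^bsub>T\<^esub> coset y"
      using diff by (intro coset_add; simp)+
    moreover have "coset z \<in> carrier T \<and> coset (- z) \<in> carrier T" if "z \<in> {x, y}" for z
      using diff that by (auto intro!: coset_closed)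
    ultimately show ?case
      using add diff by simp
  next
    case (frag p)
    then obtain a b where p: "p = (a, b)" "a \<in> carrier A" "b \<in> carrier B" by auto
    have "pure_tensor k A B (\<ominus>\<^bsub>A\<^esub> a) b = coset (- frag_of (a, b))"
      using p by (simp only: pure_uminus_left) (simp add: pure_tensor_coset coset_uminus)
    then show ?case
      using pure[of a b] pure[of "\<ominus>\<^bsub>A\<^esub> a" b] p by (simp add: pure_tensor_coset)
  qed
  then show ?thesis
    using c by simp
qed

text \<open>The sum over a formal sum is a homomorphism that kills the bilinearity relations. It is therefore
  constant on cosets, and the image in the definition of the induced map is a singleton.\<close>

lemma tensor_hom_coset:
  assumes M: "abelian_group M" and \<beta>: "balanced k A B M \<beta>" and c: "c \<in> carrier F"
  shows "tensor_hom M \<beta> (coset c) = formal_sum (add_monoid M) \<beta> c"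
proof -
  interpret M: abelian_group M by fact
  let ?\<phi> = "formal_sum (add_monoid M) \<beta>"
  have hom: "?\<phi> \<in> hom F (add_monoid M)"
    by (rule M.a_comm_group[THEN comm_group.formal_sum_hom]) (use \<beta> in \<open>simp add: balanced_def\<close>)
  interpret \<phi>: group_hom F "add_monoid M" ?\<phi>
    by (simp add: group_hom_def group_hom_axioms_def hom F.is_group M.a_group)
  have frag: "?\<phi> (frag_of (a, b)) = \<beta> a b" if "a \<in> carrier A" "b \<in> carrier B" for a b
    using \<beta> that by (intro M.a_comm_group[THEN comm_group.formal_sum_frag_of]) (simp add: balanced_def)
  have diff: "?\<phi> (x - y) = ?\<phi> x \<ominus>\<^bsub>M\<^esub> ?\<phi> y" if "x \<in> carrier F" "y \<in> carrier F" for x y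
    using \<phi>.hom_mult[of x "- y"] \<phi>.hom_inv[of y] that by (simp add: a_minus_def a_inv_def)
  have diff2: "?\<phi> (x - y - z) = ?\<phi> x \<ominus>\<^bsub>M\<^esub> ?\<phi> y \<ominus>\<^bsub>M\<^esub> ?\<phi> z"
    if "x \<in> carrier F" "y \<in> carrier F" "z \<in> carrier F" for x y z
    using that diff[of "x - y" z] diff[of x y] keys_diff[of x y] by auto
  have cancel: "x \<oplus>\<^bsub>M\<^esub> y \<ominus>\<^bsub>M\<^esub> x \<ominus>\<^bsub>M\<^esub> y = \<zero>\<^bsub>M\<^esub>" if "x \<in> carrier M" "y \<in> carrier M" for x y
    using that by (simp add: M.minus_eq M.a_comm[of x y] M.a_assoc M.r_neg)
  have "tensor_relations k A B \<subseteq> kernel F (add_monoid M) ?\<phi>"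
  proof
    fix z assume z: "z \<in> tensor_relations k A B"
    then have zF: "z \<in> carrier F" using tensor_relations_closed by blast
    have "?\<phi> z = \<zero>\<^bsub>M\<^esub>"
      using z unfolding tensor_relations_def
    proof (elim UnE CollectE exE conjE)
      fix a a' b
      assume "z = frag_of (a \<oplus>\<^bsub>A\<^esub> a', b) - frag_of (a, b) - frag_of (a', b)"
        and *: "a \<in> carrier A" "a' \<in> carrier A" "b \<in> carrier B"
      moreover have "\<beta> (a \<oplus>\<^bsub>A\<^esub> a') b = \<beta> a b \<oplus>\<^bsub>M\<^esub> \<beta> a' b" "\<beta> a b \<in> carrier M" "\<beta> a' b \<in> carrier M"
        using \<beta> * by (simp_all add: balanced_def)
      ultimately show ?thesis
        by (simp add: diff2 frag cancel)
    next
      fix a b b'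
      assume "z = frag_of (a, b \<oplus>\<^bsub>B\<^esub> b') - frag_of (a, b) - frag_of (a, b')"
        and *: "a \<in> carrier A" "b \<in> carrier B" "b' \<in> carrier B"
      moreover have "\<beta> a (b \<oplus>\<^bsub>B\<^esub> b') = \<beta> a b \<oplus>\<^bsub>M\<^esub> \<beta> a b'" "\<beta> a b \<in> carrier M" "\<beta> a b' \<in> carrier M"
        using \<beta> * by (simp_all add: balanced_def)
      ultimately show ?thesis
        by (simp add: diff2 frag cancel)
    next
      fix r a b
      assume "z = frag_of (r \<odot>\<^bsub>A\<^esub> a, b) - frag_of (a, r \<odot>\<^bsub>B\<^esub> b)"
        and *: "r \<in> carrier k" "a \<in> carrier A" "b \<in> carrier B"
      moreover have "\<beta> (r \<odot>\<^bsub>A\<^esub> a) b = \<beta> a (r \<odot>\<^bsub>B\<^esub> b)" "\<beta> a (r \<odot>\<^bsub>B\<^esub> b) \<in> carrier M"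
        using \<beta> * by (simp_all add: balanced_def)
      ultimately show ?thesis
        by (simp add: diff frag M.minus_eq M.r_neg)
    qed
    then show "z \<in> kernel F (add_monoid M) ?\<phi>"
      using zF by (simp add: kernel_def)
  qed
  then have "N \<subseteq> kernel F (add_monoid M) ?\<phi>"
    unfolding tensor_null_def by (rule F.generate_subgroup_incl) (rule \<phi>.subgroup_kernel)
  then have "?\<phi> (n + c) = ?\<phi> c" if "n \<in> N" for n
    using \<phi>.hom_mult[of n c] that c M.l_zero[of "?\<phi> c"] \<phi>.hom_closed[of c] by (auto simp: kernel_def)
  moreover have "coset c = (\<lambda>n. n + c) ` N"
    by (auto simp: r_coset_def)
  moreover have "N \<noteq> {}"
    using N.one_closed by auto
  ultimately show ?thesis
    by (simp add: tensor_lift_formal_sum image_image image_constant_conv)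
qed

lemma tensor_hom_pure:
  assumes M: "abelian_group M" and \<beta>: "balanced k A B M \<beta>" and "a \<in> carrier A" "b \<in> carrier B"
  shows "tensor_hom M \<beta> (pure_tensor k A B a b) = \<beta> a b"
proof -
  interpret M: abelian_group M by fact
  show ?thesis
    using assms comm_group.formal_sum_frag_of[OF M.a_comm_group, of \<beta> a b]
    by (simp add: pure_tensor_coset tensor_hom_coset balanced_def)
qed

lemma tensor_hom_add:
  assumes M: "abelian_group M" and \<beta>: "balanced k A B M \<beta>" and X: "X \<in> carrier T" and Y: "Y \<in> carrier T"
  shows "tensor_hom M \<beta> (X \<oplus>\<^bsub>T\<^esub> Y) = tensor_hom M \<beta> X \<oplus>\<^bsub>M\<^esub> tensor_hom M \<beta> Y"
proof -
  interpret M: abelian_group M by fact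
  obtain c d where cd: "X = coset c" "c \<in> carrier F" "Y = coset d" "d \<in> carrier F"
    using X Y by (auto simp: carrier_tensor)
  have "formal_sum (add_monoid M) \<beta> \<in> hom F (add_monoid M)"
    by (rule M.a_comm_group[THEN comm_group.formal_sum_hom]) (use \<beta> in \<open>simp add: balanced_def\<close>)
  from hom_mult[OF this cd(2,4)] show ?thesis
    using cd M \<beta> N.rcos_sum F.m_closed[OF cd(2,4)]
    by (simp add: tensor_hom_coset flip: coset_add)
qed

lemma tensor_hom_closed:
  assumes M: "abelian_group M" and \<beta>: "balanced k A B M \<beta>" and X: "X \<in> carrier T"
  shows "tensor_hom M \<beta> X \<in> carrier M"
proof -
  interpret M: abelian_group M by fact
  show ?thesis
    using X
  proof (induction rule: tensor_induct)
    case (pure a b)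
    then show ?case
      using \<beta> by (simp add: tensor_hom_pure[OF M \<beta>]) (simp add: balanced_def)
  qed (simp add: tensor_hom_add[OF M \<beta>])
qed

lemma smult_tensor_hom:
  "r \<odot>\<^bsub>T\<^esub> X = tensor_hom T (\<lambda>a b. pure_tensor k A B (r \<odot>\<^bsub>A\<^esub> a) b) X"
  by (simp add: tensor_lift_group flip: tensor_lift_group) (simp add: tensor_def)

lemma balanced_smult: "r \<in> carrier k \<Longrightarrow> balanced k A B T (\<lambda>a b. pure_tensor k A B (r \<odot>\<^bsub>A\<^esub> a) b)"
  by (simp add: balanced_def A.smult_r_distr pure_add_left pure_add_right
      A.R.m_comm flip: pure_smult_left_right A.smult_assoc1)

lemma smult_pure [simp]:
  assumes "r \<in> carrier k" "a \<in> carrier A" "b \<in> carrier B"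
  shows "r \<odot>\<^bsub>T\<^esub> pure_tensor k A B a b = pure_tensor k A B (r \<odot>\<^bsub>A\<^esub> a) b"
  using assms by (simp add: smult_tensor_hom tensor_hom_pure balanced_smult tensor_abelian_group)

lemma tensor_module: "module k T"
proof (rule moduleI)
  show closed: "r \<odot>\<^bsub>T\<^esub> X \<in> carrier T" if "r \<in> carrier k" "X \<in> carrier T" for r X
    using that by (simp add: smult_tensor_hom tensor_hom_closed balanced_smult tensor_abelian_group)
  show distr: "r \<odot>\<^bsub>T\<^esub> (X \<oplus>\<^bsub>T\<^esub> Y) = r \<odot>\<^bsub>T\<^esub> X \<oplus>\<^bsub>T\<^esub> r \<odot>\<^bsub>T\<^esub> Y"
    if "r \<in> carrier k" "X \<in> carrier T" "Y \<in> carrier T" for r X Y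
    using that by (simp add: smult_tensor_hom tensor_hom_add balanced_smult tensor_abelian_group)
  show "(r \<oplus>\<^bsub>k\<^esub> r') \<odot>\<^bsub>T\<^esub> X = r \<odot>\<^bsub>T\<^esub> X \<oplus>\<^bsub>T\<^esub> r' \<odot>\<^bsub>T\<^esub> X"
    if "r \<in> carrier k" "r' \<in> carrier k" "X \<in> carrier T" for r r' X
    using that(3) by (induction rule: tensor_induct)
      (simp_all add: that A.smult_l_distr pure_add_left distr closed T.a_ac)
  show "(r \<otimes>\<^bsub>k\<^esub> r') \<odot>\<^bsub>T\<^esub> X = r \<odot>\<^bsub>T\<^esub> (r' \<odot>\<^bsub>T\<^esub> X)"
    if "r \<in> carrier k" "r' \<in> carrier k" "X \<in> carrier T" for r r' X
    using that(3) by (induction rule: tensor_induct) (simp_all add: that A.smult_assoc1 distr closed)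
  show "\<one>\<^bsub>k\<^esub> \<odot>\<^bsub>T\<^esub> X = X" if "X \<in> carrier T" for X
    using that by (induction rule: tensor_induct) (simp_all add: distr)
qed (unfold_locales)

end


text \<open>Linearity is decided by the syntax of an expression: there is one rule for each operation and each
  argument position in which the variable may occur. Used as introduction rules, they reduce
  bilinearity and trilinearity of a map to membership in carriers. General composition is not among
  them, since its unification problem has no most general solution.\<close>

named_theorems linear_intros

declare linear_map_ident [linear_intros]

lemma linear_map_smult_left [linear_intros]:
  assumes "module k M" "linear_map k C M f" "r \<in> carrier k"
  shows "linear_map k C M (\<lambda>x. r \<odot>\<^bsub>M\<^esub> f x)"
proof -
  interpret M: module k M by fact
  show ?thesis
    using assms by (simp add: linear_map_def M.smult_r_distr M.m_comm flip: M.smult_assoc1)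
qed

context module_pair
begin

lemma linear_pure_left [linear_intros]:
  "linear_map k C A f \<Longrightarrow> b \<in> carrier B \<Longrightarrow> linear_map k C T (\<lambda>x. pure_tensor k A B (f x) b)"
  by (simp add: linear_map_def pure_add_left)

lemma pure_smult_right:
  "r \<in> carrier k \<Longrightarrow> a \<in> carrier A \<Longrightarrow> b \<in> carrier B \<Longrightarrow>
    pure_tensor k A B a (r \<odot>\<^bsub>B\<^esub> b) = r \<odot>\<^bsub>T\<^esub> pure_tensor k A B a b"
  by (simp add: pure_smult_left_right)

lemma linear_pure_right [linear_intros]:
  "linear_map k C B f \<Longrightarrow> a \<in> carrier A \<Longrightarrow> linear_map k C T (\<lambda>x. pure_tensor k A B a (f x))"
  by (simp add: linear_map_def pure_add_right pure_smult_right)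

sublocale T: module k T
  by (rule tensor_module)

context
  fixes M :: "('k, 'c) module" and \<beta>
  assumes \<beta>: "bilinear_map k A B M \<beta>" and M: "module k M"
begin

interpretation M: module k M by (rule M)

lemma tensor_hom_bilinear_pure:
  "a \<in> carrier A \<Longrightarrow> b \<in> carrier B \<Longrightarrow> tensor_hom M \<beta> (pure_tensor k A B a b) = \<beta> a b"
  by (rule tensor_hom_pure[OF M.abelian_group_axioms bilinear_map_balanced[OF \<beta>]])

lemma linear_tensor_hom: "linear_map k T M (tensor_hom M \<beta>)"
proof (rule linear_mapI)
  note bal = bilinear_map_balanced[OF \<beta>] and M' = M.abelian_group_axioms
  show closed: "tensor_hom M \<beta> X \<in> carrier M" if "X \<in> carrier T" for X
    by (rule tensor_hom_closed[OF M' bal that])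
  show add: "tensor_hom M \<beta> (X \<oplus>\<^bsub>T\<^esub> Y) = tensor_hom M \<beta> X \<oplus>\<^bsub>M\<^esub> tensor_hom M \<beta> Y"
    if "X \<in> carrier T" "Y \<in> carrier T" for X Y
    by (rule tensor_hom_add[OF M' bal that])
  show "tensor_hom M \<beta> (r \<odot>\<^bsub>T\<^esub> X) = r \<odot>\<^bsub>M\<^esub> tensor_hom M \<beta> X"
    if r: "r \<in> carrier k" and "X \<in> carrier T" for r X
    using that(2)
  proof (induction rule: tensor_induct)
    case (pure a b)
    then show ?case
      using r by (simp add: tensor_hom_bilinear_pure linear_map_smult[OF bilinear_map_left[OF \<beta>]])
  next
    case (add X Y)
    then show ?case
      using r by (simp add: T.smult_r_distr M.smult_r_distr tensor_hom_add[OF M' bal] closed)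
  qed
qed

lemma tensor_hom_ext:
  assumes f: "linear_map k T M f" and X: "X \<in> carrier T"
    and eq: "\<And>a b. a \<in> carrier A \<Longrightarrow> b \<in> carrier B \<Longrightarrow> f (pure_tensor k A B a b) = \<beta> a b"
  shows "f X = tensor_hom M \<beta> X"
  using X by (induction rule: tensor_induct)
    (simp_all add: eq tensor_hom_bilinear_pure linear_map_add[OF f] linear_map_add[OF linear_tensor_hom])

end

lemma linear_map_ext:
  assumes f: "linear_map k T M f" and g: "linear_map k T M g" and X: "X \<in> carrier T"
    and eq: "\<And>a b. a \<in> carrier A \<Longrightarrow> b \<in> carrier B \<Longrightarrow>
      f (pure_tensor k A B a b) = g (pure_tensor k A B a b)"
  shows "f X = g X"
  using X by (induction rule: tensor_induct) (simp_all add: eq linear_map_add[OF f] linear_map_add[OF g])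

lemma linear_map_tensor_hom [linear_intros]:
  "bilinear_map k A B M \<beta> \<Longrightarrow> module k M \<Longrightarrow> linear_map k C T f \<Longrightarrow>
    linear_map k C M (\<lambda>x. tensor_hom M \<beta> (f x))"
  by (rule linear_map_comp[OF linear_tensor_hom])

text \<open>The variable may also occur in the bilinear map rather than in the tensor at which it is evaluated. This
  makes it possible to nest induced maps.\<close>

lemma linear_map_tensor_hom_param [linear_intros]:
  assumes M: "module k M" and C: "module k C" and X: "X \<in> carrier T"
    and bil: "\<And>x. x \<in> carrier C \<Longrightarrow> bilinear_map k A B M (\<beta> x)"
    and lin: "\<And>a b. a \<in> carrier A \<Longrightarrow> b \<in> carrier B \<Longrightarrow> linear_map k C M (\<lambda>x. \<beta> x a b)"
  shows "linear_map k C M (\<lambda>x. tensor_hom M (\<beta> x) X)"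
proof -
  interpret M: module k M by (rule M)
  interpret C: module k C by (rule C)
  note closed = linear_map_closed[OF linear_tensor_hom[OF bil M]]
    and hom_add = linear_map_add[OF linear_tensor_hom[OF bil M]]
    and hom_pure = tensor_hom_bilinear_pure[OF bil M]
  show ?thesis
  proof (rule linear_mapI)
    show "tensor_hom M (\<beta> x) X \<in> carrier M" if "x \<in> carrier C" for x
      using that X by (rule closed)
    show "tensor_hom M (\<beta> (x \<oplus>\<^bsub>C\<^esub> y)) X = tensor_hom M (\<beta> x) X \<oplus>\<^bsub>M\<^esub> tensor_hom M (\<beta> y) X"
      if xy: "x \<in> carrier C" "y \<in> carrier C" for x y
      using X
    proof (induction rule: tensor_induct)
      case (pure a b)
      then show ?case
        using xy by (simp add: hom_pure linear_map_add[OF lin])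
    next
      case (add X Y)
      then show ?case
        using xy by (simp add: hom_add closed M.a_ac)
    qed
    show "tensor_hom M (\<beta> (r \<odot>\<^bsub>C\<^esub> x)) X = r \<odot>\<^bsub>M\<^esub> tensor_hom M (\<beta> x) X"
      if rx: "r \<in> carrier k" "x \<in> carrier C" for r x
      using X
    proof (induction rule: tensor_induct)
      case (pure a b)
      then show ?case
        using rx by (simp add: hom_pure linear_map_smult[OF lin])
    next
      case (add X Y)
      then show ?case
        using rx by (simp add: hom_add closed M.smult_r_distr)
    qed
  qed
qed

end


section \<open>Tensor products of algebras\<close>

context k_algebra
begin

lemma linear_map_mult_right [linear_intros]:
  "linear_map k C A f \<Longrightarrow> c \<in> carrier A \<Longrightarrow> linear_map k C A (\<lambda>x. f x \<otimes> c)"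
  by (simp add: linear_map_def l_distr smult_mult_left)

lemma linear_map_mult_left [linear_intros]:
  "linear_map k C A f \<Longrightarrow> c \<in> carrier A \<Longrightarrow> linear_map k C A (\<lambda>x. c \<otimes> f x)"
  by (simp add: linear_map_def r_distr smult_mult_right)

lemmas k_algebra_facts [simp] = module_axioms k_algebra_axioms

end

lemma k_algebraI:
  assumes "module k A"
    and closed: "\<And>x y. x \<in> carrier A \<Longrightarrow> y \<in> carrier A \<Longrightarrow> x \<otimes>\<^bsub>A\<^esub> y \<in> carrier A"
    and one: "\<one>\<^bsub>A\<^esub> \<in> carrier A"
    and assoc: "\<And>x y z. x \<in> carrier A \<Longrightarrow> y \<in> carrier A \<Longrightarrow> z \<in> carrier A \<Longrightarrow>
      x \<otimes>\<^bsub>A\<^esub> y \<otimes>\<^bsub>A\<^esub> z = x \<otimes>\<^bsub>A\<^esub> (y \<otimes>\<^bsub>A\<^esub> z)"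
    and l_one: "\<And>x. x \<in> carrier A \<Longrightarrow> \<one>\<^bsub>A\<^esub> \<otimes>\<^bsub>A\<^esub> x = x"
    and r_one: "\<And>x. x \<in> carrier A \<Longrightarrow> x \<otimes>\<^bsub>A\<^esub> \<one>\<^bsub>A\<^esub> = x"
    and bil: "bilinear_map k A A A (monoid.mult A)"
  shows "k_algebra k A"
proof -
  interpret M: module k A by fact
  note left = bilinear_map_left[OF bil] and right = bilinear_map_right[OF bil]
  have "monoid A"
    by (rule monoidI) (use closed one assoc l_one r_one in auto)
  then have "ring A"
    by (intro ringI M.abelian_group_axioms) (simp_all add: linear_map_add[OF left] linear_map_add[OF right])
  then show ?thesis
    by (intro k_algebra.intro k_algebra_axioms.intro)
      (simp_all add: assms(1) linear_map_smult[OF left] linear_map_smult[OF right])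
qed

locale tensor_pair = A: k_algebra k A + B: k_algebra k B
  for k :: "'k ring" and A :: "('k, 'a) module" and B :: "('k, 'b) module"
begin

sublocale module_pair k A B ..

text \<open>The bilinearity and associativity of the product are inherited from pure tensors, once the nested
  induced maps in its definition are expressed through the module structure.\<close>

lemma mult_tensor:
  "X \<otimes>\<^bsub>T\<^esub> Y = tensor_hom T (\<lambda>a b. tensor_hom T (\<lambda>a' b'. pure_tensor k A B (a \<otimes>\<^bsub>A\<^esub> a') (b \<otimes>\<^bsub>B\<^esub> b')) Y) X"
  by (simp flip: tensor_lift_group) (simp add: tensor_def)

lemma one_tensor: "\<one>\<^bsub>T\<^esub> = pure_tensor k A B \<one>\<^bsub>A\<^esub> \<one>\<^bsub>B\<^esub>"
  by (simp add: tensor_def)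

lemma bilinear_pure_mult:
  "a \<in> carrier A \<Longrightarrow> b \<in> carrier B \<Longrightarrow>
    bilinear_map k A B T (\<lambda>a' b'. pure_tensor k A B (a \<otimes>\<^bsub>A\<^esub> a') (b \<otimes>\<^bsub>B\<^esub> b'))"
  by (intro bilinear_mapI linear_intros) simp_all

lemma bilinear_tensor_mult:
  "Y \<in> carrier T \<Longrightarrow>
    bilinear_map k A B T (\<lambda>a b. tensor_hom T (\<lambda>a' b'. pure_tensor k A B (a \<otimes>\<^bsub>A\<^esub> a') (b \<otimes>\<^bsub>B\<^esub> b')) Y)"
  by (intro bilinear_mapI linear_intros) (simp_all add: T.module_axioms)

lemma mult_pure [simp]:
  assumes "a \<in> carrier A" "b \<in> carrier B" "a' \<in> carrier A" "b' \<in> carrier B"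
  shows "pure_tensor k A B a b \<otimes>\<^bsub>T\<^esub> pure_tensor k A B a' b' = pure_tensor k A B (a \<otimes>\<^bsub>A\<^esub> a') (b \<otimes>\<^bsub>B\<^esub> b')"
  using assms
  by (simp add: mult_tensor tensor_hom_bilinear_pure bilinear_tensor_mult bilinear_pure_mult T.module_axioms)

lemma bilinear_mult: "bilinear_map k T T T (monoid.mult T)"
proof (rule bilinear_mapI)
  fix X assume X: "X \<in> carrier T"
  show "linear_map k T T (\<lambda>Y. Y \<otimes>\<^bsub>T\<^esub> X)"
    unfolding mult_tensor
    by (intro linear_intros bilinear_tensor_mult X) (rule T.module_axioms)
  show "linear_map k T T (\<lambda>Y. X \<otimes>\<^bsub>T\<^esub> Y)"
    unfolding mult_tensor
    by (intro linear_intros bilinear_mapI bilinear_tensor_mult X) (simp_all add: T.module_axioms)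
qed

lemma tensor_k_algebra: "k_algebra k T"
proof -
  note left = bilinear_map_left[OF bilinear_mult] and right = bilinear_map_right[OF bilinear_mult]
  note add = linear_map_add[OF left] linear_map_add[OF right]
  have closed: "X \<otimes>\<^bsub>T\<^esub> Y \<in> carrier T" if "X \<in> carrier T" "Y \<in> carrier T" for X Y
    using that by (rule linear_map_closed[OF right])
  show ?thesis
  proof (rule k_algebraI)
    fix X Y Z assume X: "X \<in> carrier T" and Y: "Y \<in> carrier T" and Z: "Z \<in> carrier T"
    have pp: "pure_tensor k A B a b \<otimes>\<^bsub>T\<^esub> pure_tensor k A B a' b' \<otimes>\<^bsub>T\<^esub> Z =
        pure_tensor k A B a b \<otimes>\<^bsub>T\<^esub> (pure_tensor k A B a' b' \<otimes>\<^bsub>T\<^esub> Z)"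
      if "a \<in> carrier A" "b \<in> carrier B" "a' \<in> carrier A" "b' \<in> carrier B" for a b a' b'
      using Z by (induction rule: tensor_induct)
        (use that in \<open>simp_all add: A.m_assoc B.m_assoc add closed del: mult_pure,
          simp_all add: A.m_assoc B.m_assoc\<close>)
    have p: "pure_tensor k A B a b \<otimes>\<^bsub>T\<^esub> Y \<otimes>\<^bsub>T\<^esub> Z = pure_tensor k A B a b \<otimes>\<^bsub>T\<^esub> (Y \<otimes>\<^bsub>T\<^esub> Z)"
      if "a \<in> carrier A" "b \<in> carrier B" for a b
      using Y by (induction rule: tensor_induct) (use that Z in \<open>simp_all add: pp add closed del: mult_pure\<close>)
    show "X \<otimes>\<^bsub>T\<^esub> Y \<otimes>\<^bsub>T\<^esub> Z = X \<otimes>\<^bsub>T\<^esub> (Y \<otimes>\<^bsub>T\<^esub> Z)"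
      using X by (induction rule: tensor_induct) (use Y Z in \<open>simp_all add: p add closed\<close>)
  next
    fix X assume X: "X \<in> carrier T"
    show "\<one>\<^bsub>T\<^esub> \<otimes>\<^bsub>T\<^esub> X = X"
      using X by (induction rule: tensor_induct) (simp_all add: one_tensor add)
    show "X \<otimes>\<^bsub>T\<^esub> \<one>\<^bsub>T\<^esub> = X"
      using X by (induction rule: tensor_induct) (simp_all add: one_tensor add)
  qed (simp_all add: closed bilinear_mult one_tensor T.module_axioms)
qed

sublocale T: k_algebra k T
  by (rule tensor_k_algebra)

end


section \<open>Homomorphisms\<close>

lemma algebra_hom_linear: "f \<in> algebra_hom k A B \<Longrightarrow> linear_map k A B f"
  by (auto simp: algebra_hom_def linear_map_def ring_hom_add ring_hom_closed)

lemma algebra_hom_mult: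
  "f \<in> algebra_hom k A B \<Longrightarrow> x \<in> carrier A \<Longrightarrow> y \<in> carrier A \<Longrightarrow> f (x \<otimes>\<^bsub>A\<^esub> y) = f x \<otimes>\<^bsub>B\<^esub> f y"
  by (auto simp: algebra_hom_def ring_hom_mult)

lemma algebra_hom_one: "f \<in> algebra_hom k A B \<Longrightarrow> f \<one>\<^bsub>A\<^esub> = \<one>\<^bsub>B\<^esub>"
  by (auto simp: algebra_hom_def ring_hom_one)

lemma algebra_homI:
  assumes "linear_map k A B f"
    and "\<And>x y. x \<in> carrier A \<Longrightarrow> y \<in> carrier A \<Longrightarrow> f (x \<otimes>\<^bsub>A\<^esub> y) = f x \<otimes>\<^bsub>B\<^esub> f y"
    and "f \<one>\<^bsub>A\<^esub> = \<one>\<^bsub>B\<^esub>"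
  shows "f \<in> algebra_hom k A B"
  using assms by (auto simp: algebra_hom_def linear_map_def intro!: ring_hom_memI)

lemma algebra_hom_ident: "(\<lambda>x. x) \<in> algebra_hom k A A"
  by (rule algebra_homI) (simp_all add: linear_map_ident)

text \<open>Both sides of the multiplication law are bilinear, so that pure tensors suffice.\<close>

lemma (in tensor_pair) algebra_hom_tensorI:
  assumes C: "k_algebra k C" and f: "linear_map k T C f"
    and mult: "\<And>a b a' b'. a \<in> carrier A \<Longrightarrow> b \<in> carrier B \<Longrightarrow> a' \<in> carrier A \<Longrightarrow> b' \<in> carrier B \<Longrightarrow>
      f (pure_tensor k A B (a \<otimes>\<^bsub>A\<^esub> a') (b \<otimes>\<^bsub>B\<^esub> b')) = f (pure_tensor k A B a b) \<otimes>\<^bsub>C\<^esub> f (pure_tensor k A B a' b')"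
    and one: "f (pure_tensor k A B \<one>\<^bsub>A\<^esub> \<one>\<^bsub>B\<^esub>) = \<one>\<^bsub>C\<^esub>"
  shows "f \<in> algebra_hom k T C"
proof (rule algebra_homI)
  interpret C: k_algebra k C by (rule C)
  note add = linear_map_add[OF f] and closed = linear_map_closed[OF f]
  fix X Y assume X: "X \<in> carrier T" and Y: "Y \<in> carrier T"
  have *: "f (pure_tensor k A B a b \<otimes>\<^bsub>T\<^esub> Y) = f (pure_tensor k A B a b) \<otimes>\<^bsub>C\<^esub> f Y"
    if "a \<in> carrier A" "b \<in> carrier B" for a b
    using Y by (induction rule: tensor_induct) (use that in \<open>simp_all add: mult add closed T.r_distr C.r_distr\<close>)
  show "f (X \<otimes>\<^bsub>T\<^esub> Y) = f X \<otimes>\<^bsub>C\<^esub> f Y"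
    using X by (induction rule: tensor_induct) (use Y in \<open>simp_all add: * add closed T.l_distr C.l_distr\<close>)
qed (simp_all add: f one one_tensor)

locale tensor_map_pair = AB: module_pair k A B + CD: module_pair k C D
  for k :: "'k ring" and A :: "('k, 'a) module" and B :: "('k, 'b) module"
    and C :: "('k, 'c) module" and D :: "('k, 'd) module" +
  fixes f g
  assumes f: "linear_map k A C f" and g: "linear_map k B D g"
begin

lemma bilinear_tensor_map: "bilinear_map k A B (tensor k C D) (\<lambda>a b. pure_tensor k C D (f a) (g b))"
  by (intro bilinear_mapI linear_intros f g linear_map_closed[OF f] linear_map_closed[OF g])

lemma tensor_map_linear: "linear_map k (tensor k A B) (tensor k C D) (tensor_map k C D f g)"
  unfolding tensor_map_hom by (rule AB.linear_tensor_hom[OF bilinear_tensor_map CD.tensor_module])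

lemma tensor_map_pure:
  "a \<in> carrier A \<Longrightarrow> b \<in> carrier B \<Longrightarrow>
    tensor_map k C D f g (pure_tensor k A B a b) = pure_tensor k C D (f a) (g b)"
  unfolding tensor_map_hom by (rule AB.tensor_hom_bilinear_pure[OF bilinear_tensor_map CD.tensor_module])

end

lemma tensor_map_pairI:
  assumes "linear_map k A C f" "linear_map k B D g" "module k A" "module k B" "module k C" "module k D"
  shows "tensor_map_pair k A B C D f g"
  using assms by (simp add: tensor_map_pair_def module_pair_def tensor_map_pair_axioms_def)

lemmas linear_tensor_map = tensor_map_pair.tensor_map_linear[OF tensor_map_pairI]
lemmas tensor_map_pure = tensor_map_pair.tensor_map_pure[OF tensor_map_pairI]

lemma tensor_map_algebra_hom:
  assumes f: "f \<in> algebra_hom k A C" and g: "g \<in> algebra_hom k B D"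
    and "k_algebra k A" "k_algebra k B" "k_algebra k C" "k_algebra k D"
  shows "tensor_map k C D f g \<in> algebra_hom k (tensor k A B) (tensor k C D)"
proof -
  interpret AB: tensor_pair k A B using assms by (simp add: tensor_pair_def)
  interpret CD: tensor_pair k C D using assms by (simp add: tensor_pair_def)
  note fg = algebra_hom_linear[OF f] algebra_hom_linear[OF g]
  show ?thesis
    by (rule AB.algebra_hom_tensorI)
      (simp_all add: linear_tensor_map fg tensor_map_pure algebra_hom_mult[OF f] algebra_hom_mult[OF g]
        algebra_hom_one[OF f] algebra_hom_one[OF g] linear_map_closed[OF fg(1)] linear_map_closed[OF fg(2)]
        CD.one_tensor)
qed

lemma tensor_map_comp:
  assumes "linear_map k A C f" "linear_map k B D g" "linear_map k C E f'" "linear_map k D H g'"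
    and mods: "module k A" "module k B" "module k C" "module k D" "module k E" "module k H"
    and X: "X \<in> carrier (tensor k A B)"
  shows "tensor_map k E H f' g' (tensor_map k C D f g X) = tensor_map k E H (\<lambda>x. f' (f x)) (\<lambda>x. g' (g x)) X"
proof -
  interpret AB: module_pair k A B using mods by (simp add: module_pair_def)
  note lin = linear_map_comp[OF assms(3,1)] linear_map_comp[OF assms(4,2)]
  show ?thesis
    by (rule AB.linear_map_ext[OF _ _ X])
      (auto intro!: linear_map_comp[OF linear_tensor_map linear_tensor_map] linear_tensor_map lin assms
        simp: tensor_map_pure assms lin linear_map_closed[OF assms(1)] linear_map_closed[OF assms(2)])
qed

lemma tensor_map_cong:
  assumes "linear_map k A C f" "linear_map k B D g"
    and mods: "module k A" "module k B" "module k C" "module k D"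
    and eq: "\<And>x. x \<in> carrier A \<Longrightarrow> f' x = f x" "\<And>x. x \<in> carrier B \<Longrightarrow> g' x = g x"
    and X: "X \<in> carrier (tensor k A B)"
  shows "tensor_map k C D f' g' X = tensor_map k C D f g X"
proof -
  interpret AB: module_pair k A B using mods by (simp add: module_pair_def)
  have lin: "linear_map k A C f'" "linear_map k B D g'"
    using assms linear_map_cong by blast+
  show ?thesis
    by (rule AB.linear_map_ext[OF _ _ X])
      (auto intro!: linear_tensor_map lin assms simp: tensor_map_pure assms lin)
qed

lemma tensor_map_ident:
  assumes mods: "module k A" "module k B" and X: "X \<in> carrier (tensor k A B)"
  shows "tensor_map k A B (\<lambda>x. x) (\<lambda>x. x) X = X"
proof -
  interpret AB: module_pair k A B using mods by (simp add: module_pair_def)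
  show ?thesis
    by (rule AB.linear_map_ext[OF _ _ X, of "tensor k A B" _ "\<lambda>x. x"])
      (simp_all add: linear_tensor_map linear_map_ident mods tensor_map_pure)
qed


section \<open>Opposite algebras\<close>

lemma opposite_simps [simp]:
  "carrier (opposite A) = carrier A" "add (opposite A) = add A" "\<zero>\<^bsub>opposite A\<^esub> = \<zero>\<^bsub>A\<^esub>"
  "\<one>\<^bsub>opposite A\<^esub> = \<one>\<^bsub>A\<^esub>" "smult (opposite A) = smult A" "x \<otimes>\<^bsub>opposite A\<^esub> y = y \<otimes>\<^bsub>A\<^esub> x"
  by (simp_all add: opposite_def)

lemma linear_map_opposite [simp]:
  "linear_map k A (opposite B) f \<longleftrightarrow> linear_map k A B f" "linear_map k (opposite A) B f \<longleftrightarrow> linear_map k A B f"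
  by (simp_all add: linear_map_def)

lemma (in k_algebra) opposite_k_algebra: "k_algebra k (opposite A)"
proof (rule k_algebraI)
  have "abelian_group (opposite A)"
    by (rule abelian_groupI) (auto simp: a_ac intro: bexI[of _ "\<ominus> x" for x] l_neg)
  then show "module k (opposite A)"
    by (intro moduleI R.is_cring) (auto simp: smult_l_distr smult_r_distr smult_assoc1)
  show "bilinear_map k (opposite A) (opposite A) (opposite A) (monoid.mult (opposite A))"
    by (intro bilinear_mapI; simp; intro linear_intros)
qed (auto simp: m_assoc)

text \<open>The module underlying a tensor product does not depend on the multiplication of the factors, so
  elements and linear maps carry over to \<open>A \<otimes> B\<^sup>o\<^sup>p\<close> without change.\<close>

lemma tensor_group_opposite: "tensor_group k A (opposite B) = tensor_group k A B"
  by (simp add: tensor_group_def tensor_null_def tensor_relations_def)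

lemma pure_tensor_opposite: "pure_tensor k A (opposite B) = pure_tensor k A B"
  by (simp add: fun_eq_iff pure_tensor_def tensor_null_def tensor_relations_def)

lemma tensor_map_opposite: "tensor_map k A (opposite B) = tensor_map k A B"
  by (simp add: fun_eq_iff tensor_map_def tensor_group_opposite pure_tensor_opposite)

lemma tensor_opposite_simps:
  "carrier (tensor k A (opposite B)) = carrier (tensor k A B)"
  "add (tensor k A (opposite B)) = add (tensor k A B)"
  "smult (tensor k A (opposite B)) = smult (tensor k A B)"
  "\<one>\<^bsub>tensor k A (opposite B)\<^esub> = \<one>\<^bsub>tensor k A B\<^esub>"
  by (simp_all add: tensor_def tensor_group_opposite pure_tensor_opposite)

context k_algebra
begin

lemma antiauto_inv:
  assumes s: "s \<in> algebra_antiauto k A"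
  shows "inv_on A s \<in> algebra_antiauto k A"
proof -
  let ?t = "inv_on A s"
  from s have hom: "s \<in> algebra_hom k A (opposite A)" and bij: "bij_betw s (carrier A) (carrier A)"
    by (auto simp: algebra_antiauto_def)
  note lin = algebra_hom_linear[OF hom]
  have bij': "bij_betw ?t (carrier A) (carrier A)"
    by (rule bij_betw_inv_into[OF bij])
  have st: "s (?t x) = x" and t: "?t x \<in> carrier A" if "x \<in> carrier A" for x
    using that bij bij_betwE[OF bij'] by (auto simp: bij_betw_inv_into_right)
  have ts: "?t x = y" if "y \<in> carrier A" "s y = x" for x y
    using that bij by (auto simp: bij_betw_inv_into_left)
  have "?t \<in> algebra_hom k A (opposite A)"
    by (rule algebra_homI, unfold linear_map_opposite, rule linear_mapI)
      (auto intro!: ts simp: t st linear_map_add[OF lin, simplified] linear_map_smult[OF lin, simplified]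
        algebra_hom_mult[OF hom] algebra_hom_one[OF hom])
  with bij' show ?thesis
    by (simp add: algebra_antiauto_def)
qed

lemma antiauto_comp:
  assumes f: "f \<in> algebra_antiauto k A" and g: "g \<in> algebra_antiauto k A"
  shows "g \<circ> f \<in> algebra_auto k A"
proof -
  have f': "f \<in> algebra_hom k A (opposite A)" and g': "g \<in> algebra_hom k A (opposite A)"
    using assms by (auto simp: algebra_antiauto_def)
  note lin = algebra_hom_linear[OF f', simplified] algebra_hom_linear[OF g', simplified]
  have "(\<lambda>x. g (f x)) \<in> algebra_hom k A A"
    by (rule algebra_homI, rule linear_map_comp[OF lin(2,1)])
      (simp_all add: algebra_hom_mult[OF f'] algebra_hom_mult[OF g'] algebra_hom_one[OF f']
        algebra_hom_one[OF g'] linear_map_closed[OF lin(1)])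
  moreover have "bij_betw (g \<circ> f) (carrier A) (carrier A)"
    using assms by (intro bij_betw_trans[of f _ "carrier A"]) (auto simp: algebra_antiauto_def)
  ultimately show ?thesis
    by (simp add: algebra_auto_def comp_def)
qed

end


section \<open>Quantum algebras are standard oriented quantum algebras\<close>

context quantum_algebra
begin

interpretation AA: tensor_pair k A A ..

interpretation AAop: tensor_pair k A "opposite A"
  by (simp add: tensor_pair_def opposite_k_algebra)

theorem standard_oriented: "standard_oriented_quantum_algebra k A \<rho> id (inv_on A s \<circ> inv_on A s)"
proof -
  let ?t = "inv_on A s"
  let ?\<rho>' = "inv\<^bsub>tensor2 k A\<^esub> \<rho>"
  have \<rho>: "\<rho> \<in> carrier (tensor2 k A)" and \<rho>': "?\<rho>' \<in> carrier (tensor2 k A)"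
    using rho_invertible AA.T.Units_inv_closed by (auto simp: AA.T.Units_closed)
  have s: "s \<in> algebra_hom k A (opposite A)" and bij: "bij_betw s (carrier A) (carrier A)"
    using antipode by (auto simp: algebra_antiauto_def)
  have t: "?t \<in> algebra_hom k A (opposite A)"
    using antiauto_inv[OF antipode] by (simp add: algebra_antiauto_def)
  note lin = algebra_hom_linear[OF s, simplified] algebra_hom_linear[OF t, simplified]
  have ts: "?t (s x) = x" if "x \<in> carrier A" for x
    using bij that by (rule bij_betw_inv_into_left)
  have t\<rho>: "tensor_map k A A ?t ?t \<rho> = \<rho>"
  proof -
    have "tensor_map k A A ?t ?t \<rho> = tensor_map k A A ?t ?t (tensor_map k A A s s \<rho>)"
      by (simp only: antipode_antipode_rho)
    also have "\<dots> = tensor_map k A A (\<lambda>x. ?t (s x)) (\<lambda>x. ?t (s x)) \<rho>"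
      by (rule tensor_map_comp[where A = A and B = A and C = A and D = A]) (simp_all add: lin \<rho>)
    also have "\<dots> = tensor_map k A A (\<lambda>x. x) (\<lambda>x. x) \<rho>"
      by (rule tensor_map_cong[where A = A and B = A]) (simp_all add: linear_map_ident ts \<rho>)
    also have "\<dots> = \<rho>"
      by (rule tensor_map_ident) (simp_all add: \<rho>)
    finally show ?thesis .
  qed
  have U\<rho>: "tensor_map k A A (?t \<circ> ?t) (?t \<circ> ?t) \<rho> = \<rho>"
  proof -
    have "tensor_map k A A (\<lambda>x. ?t (?t x)) (\<lambda>x. ?t (?t x)) \<rho> = tensor_map k A A ?t ?t (tensor_map k A A ?t ?t \<rho>)"
      by (rule tensor_map_comp[where A = A and B = A and C = A and D = A, symmetric]) (simp_all add: lin \<rho>)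
    then show ?thesis
      by (simp add: t\<rho> comp_def)
  qed
  \<comment> \<open>multiplicative because the second factor of the target is opposite\<close>
  define \<phi> where "\<phi> = tensor_map k A (opposite A) (\<lambda>x. x) ?t"
  have \<phi>: "\<phi> \<in> algebra_hom k (tensor2 k A) (tensor k A (opposite A))"
    unfolding \<phi>_def
    by (rule tensor_map_algebra_hom) (simp_all add: algebra_hom_ident t opposite_k_algebra)
  have \<phi>\<rho>: "\<phi> \<rho> = ?\<rho>'"
    using antipode_right_rho by (simp add: \<phi>_def tensor_map_opposite id_def)
  have \<phi>\<rho>': "\<phi> ?\<rho>' = tensor_map k A (opposite A) id (?t \<circ> ?t) \<rho>"
  proof -
    have "\<phi> ?\<rho>' = tensor_map k A A (\<lambda>x. x) ?t (tensor_map k A A (\<lambda>x. x) ?t \<rho>)"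
      using antipode_right_rho by (simp add: \<phi>_def tensor_map_opposite id_def)
    also have "\<dots> = tensor_map k A A (\<lambda>x. x) (\<lambda>x. ?t (?t x)) \<rho>"
      by (rule tensor_map_comp[where A = A and B = A and C = A and D = A]) (simp_all add: lin \<rho> linear_map_ident)
    finally show ?thesis
      by (simp add: tensor_map_opposite comp_def id_def)
  qed
  have id\<rho>': "tensor_map k A (opposite A) id id ?\<rho>' = ?\<rho>'"
    using \<rho>' by (simp add: tensor_map_opposite id_def tensor_map_ident)
  note \<phi>_mult = algebra_hom_mult[OF \<phi>, symmetric] and \<phi>_one = algebra_hom_one[OF \<phi>]
  have id\<rho>: "tensor_map k A A id id \<rho> = \<rho>"
    using \<rho> by (simp add: id_def tensor_map_ident)
  have "\<phi> ?\<rho>' \<otimes>\<^bsub>tensor k A (opposite A)\<^esub> \<phi> \<rho> = \<one>\<^bsub>tensor k A (opposite A)\<^esub>"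
    "\<phi> \<rho> \<otimes>\<^bsub>tensor k A (opposite A)\<^esub> \<phi> ?\<rho>' = \<one>\<^bsub>tensor k A (opposite A)\<^esub>"
    using rho_invertible by (simp_all add: \<phi>_mult \<phi>_one \<rho> \<rho>')
  then have inverse:
    "tensor_map k A (opposite A) id (?t \<circ> ?t) \<rho> \<otimes>\<^bsub>tensor k A (opposite A)\<^esub>
       tensor_map k A (opposite A) id id ?\<rho>' = \<one>\<^bsub>tensor k A (opposite A)\<^esub>"
    "tensor_map k A (opposite A) id id ?\<rho>' \<otimes>\<^bsub>tensor k A (opposite A)\<^esub>
       tensor_map k A (opposite A) id (?t \<circ> ?t) \<rho> = \<one>\<^bsub>tensor k A (opposite A)\<^esub>"
    by (simp_all only: \<phi>\<rho> \<phi>\<rho>' id\<rho>')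
  have id_auto: "id \<in> algebra_auto k A"
    using algebra_hom_ident[of k A] by (simp add: algebra_auto_def id_def bij_betw_def)
  have U_auto: "?t \<circ> ?t \<in> algebra_auto k A"
    by (intro antiauto_comp antiauto_inv antipode)
  show ?thesis
    by (intro standard_oriented_quantum_algebra.intro standard_oriented_quantum_algebra_axioms.intro
        oriented_quantum_algebra.intro oriented_quantum_algebra_axioms.intro k_algebra_axioms
        rho_invertible rho_yang_baxter id_auto U_auto U\<rho> id\<rho> inverse) simp_all
qed

end


section \<open>Triple tensor products\<close>

context module_pair
begin

text \<open>The following three facts serve to rewrite inside a sum over components: summing over pure tensors
  gives back the tensor, linear maps commute with sums, and summands may be replaced by equal
  ones.\<close>

lemma tensor_hom_pure_comp:
  assumes f: "linear_map k T M f" and M: "module k M" and X: "X \<in> carrier T"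
  shows "tensor_hom M (\<lambda>a b. f (pure_tensor k A B a b)) X = f X"
proof -
  have "bilinear_map k A B M (\<lambda>a b. f (pure_tensor k A B a b))"
    by (intro bilinear_mapI linear_map_comp[OF f] linear_intros)
  from tensor_hom_ext[OF this M f X] show ?thesis by simp
qed

lemma linear_map_of_tensor_hom:
  assumes f: "linear_map k M M' f" and \<beta>: "bilinear_map k A B M \<beta>" and "module k M" "module k M'"
    and X: "X \<in> carrier T"
  shows "f (tensor_hom M \<beta> X) = tensor_hom M' (\<lambda>a b. f (\<beta> a b)) X"
proof (rule tensor_hom_ext[where f = "\<lambda>X. f (tensor_hom M \<beta> X)"])
  show "bilinear_map k A B M' (\<lambda>a b. f (\<beta> a b))"
    by (intro bilinear_mapI linear_map_comp[OF f] bilinear_map_left[OF \<beta>] bilinear_map_right[OF \<beta>])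
  show "linear_map k T M' (\<lambda>X. f (tensor_hom M \<beta> X))"
    by (intro linear_map_comp[OF f] linear_tensor_hom \<beta> assms)
qed (use assms in \<open>simp_all add: tensor_hom_bilinear_pure\<close>)

lemma tensor_hom_cong:
  assumes \<beta>: "bilinear_map k A B M \<beta>" and M: "module k M" and X: "X \<in> carrier T"
    and eq: "\<And>a b. a \<in> carrier A \<Longrightarrow> b \<in> carrier B \<Longrightarrow> \<beta>' a b = \<beta> a b"
  shows "tensor_hom M \<beta>' X = tensor_hom M \<beta> X"
proof -
  have "bilinear_map k A B M \<beta>'"
  proof (rule bilinear_mapI)
    show "linear_map k A M (\<lambda>a. \<beta>' a b)" if "b \<in> carrier B" for b
      using bilinear_map_left[OF \<beta> that] A.module_axioms
      by (rule linear_map_cong) (rule eq[OF _ that])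
    show "linear_map k B M (\<lambda>b. \<beta>' a b)" if "a \<in> carrier A" for a
      using bilinear_map_right[OF \<beta> that] B.module_axioms
      by (rule linear_map_cong) (rule eq[OF that])
  qed
  then show ?thesis
    by (intro linear_map_ext[where M = M and f = "tensor_hom M \<beta>'" and g = "tensor_hom M \<beta>", OF _ _ X]) (simp_all add: linear_tensor_hom \<beta> M tensor_hom_bilinear_pure eq)
qed

end

definition trilinear_map where
  "trilinear_map k A B C M \<beta> \<longleftrightarrow>
     (\<forall>b\<in>carrier B. \<forall>c\<in>carrier C. linear_map k A M (\<lambda>a. \<beta> a b c)) \<and>
     (\<forall>a\<in>carrier A. \<forall>c\<in>carrier C. linear_map k B M (\<lambda>b. \<beta> a b c)) \<and>
     (\<forall>a\<in>carrier A. \<forall>b\<in>carrier B. linear_map k C M (\<lambda>c. \<beta> a b c))"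

lemma trilinear_mapI:
  assumes "\<And>b c. b \<in> carrier B \<Longrightarrow> c \<in> carrier C \<Longrightarrow> linear_map k A M (\<lambda>a. \<beta> a b c)"
    and "\<And>a c. a \<in> carrier A \<Longrightarrow> c \<in> carrier C \<Longrightarrow> linear_map k B M (\<lambda>b. \<beta> a b c)"
    and "\<And>a b. a \<in> carrier A \<Longrightarrow> b \<in> carrier B \<Longrightarrow> linear_map k C M (\<lambda>c. \<beta> a b c)"
  shows "trilinear_map k A B C M \<beta>"
  using assms by (auto simp: trilinear_map_def)

text \<open>The two ways of inducing a map from a trilinear one, on \<open>(A \<otimes> B) \<otimes> C\<close> and on \<open>A \<otimes> (B \<otimes> C)\<close>,
  correspond under the associativity isomorphism.\<close>

locale module_triple = A: module k A + B: module k B + C: module k C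
  for k :: "'k ring" and A :: "('k, 'a) module" and B :: "('k, 'b) module" and C :: "('k, 'c) module"
begin

sublocale AB: module_pair k A B ..
sublocale BC: module_pair k B C ..
sublocale AB_C: module_pair k "tensor k A B" C ..
sublocale A_BC: module_pair k A "tensor k B C" ..

abbreviation (input) hom_left where
  "hom_left M \<beta> \<equiv> tensor_hom M (\<lambda>X c. tensor_hom M (\<lambda>a b. \<beta> a b c) X)"

abbreviation (input) hom_right where
  "hom_right M \<beta> \<equiv> tensor_hom M (\<lambda>a Y. tensor_hom M (\<beta> a) Y)"

context
  fixes M :: "('k, 'd) module" and \<beta>
  assumes \<beta>: "trilinear_map k A B C M \<beta>" and M: "module k M"
begin

lemma bilinear_slices:
  "c \<in> carrier C \<Longrightarrow> bilinear_map k A B M (\<lambda>a b. \<beta> a b c)"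
  "a \<in> carrier A \<Longrightarrow> bilinear_map k B C M (\<beta> a)"
  using \<beta> by (auto simp: trilinear_map_def intro!: bilinear_mapI)

lemma bilinear_left: "bilinear_map k (tensor k A B) C M (\<lambda>X c. tensor_hom M (\<lambda>a b. \<beta> a b c) X)"
  using \<beta> by (intro bilinear_mapI linear_intros bilinear_slices)
    (simp_all add: M C.module_axioms trilinear_map_def)

lemma bilinear_right: "bilinear_map k A (tensor k B C) M (\<lambda>a Y. tensor_hom M (\<beta> a) Y)"
  using \<beta> by (intro bilinear_mapI linear_intros bilinear_slices)
    (simp_all add: M A.module_axioms trilinear_map_def)

lemmas linear_hom_left = AB_C.linear_tensor_hom[OF bilinear_left M]
lemmas linear_hom_right = A_BC.linear_tensor_hom[OF bilinear_right M]

lemma hom_left_pure: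
  "a \<in> carrier A \<Longrightarrow> b \<in> carrier B \<Longrightarrow> c \<in> carrier C \<Longrightarrow>
    hom_left M \<beta> (pure_tensor k (tensor k A B) C (pure_tensor k A B a b) c) = \<beta> a b c"
  by (simp add: AB_C.tensor_hom_bilinear_pure[OF bilinear_left M]
      AB.tensor_hom_bilinear_pure[OF bilinear_slices(1) M])

lemma hom_right_pure:
  "a \<in> carrier A \<Longrightarrow> b \<in> carrier B \<Longrightarrow> c \<in> carrier C \<Longrightarrow>
    hom_right M \<beta> (pure_tensor k A (tensor k B C) a (pure_tensor k B C b c)) = \<beta> a b c"
  by (simp add: A_BC.tensor_hom_bilinear_pure[OF bilinear_right M]
      BC.tensor_hom_bilinear_pure[OF bilinear_slices(2) M])

end

lemma triple_ext:
  assumes f: "linear_map k (tensor k (tensor k A B) C) M f" and g: "linear_map k (tensor k (tensor k A B) C) M g"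
    and W: "W \<in> carrier (tensor k (tensor k A B) C)"
    and eq: "\<And>a b c. a \<in> carrier A \<Longrightarrow> b \<in> carrier B \<Longrightarrow> c \<in> carrier C \<Longrightarrow>
      f (pure_tensor k (tensor k A B) C (pure_tensor k A B a b) c) =
      g (pure_tensor k (tensor k A B) C (pure_tensor k A B a b) c)"
  shows "f W = g W"
proof (rule AB_C.linear_map_ext[OF f g W])
  fix X c assume X: "X \<in> carrier (tensor k A B)" and c: "c \<in> carrier C"
  have lin: "linear_map k (tensor k A B) (tensor k (tensor k A B) C) (\<lambda>X. pure_tensor k (tensor k A B) C X c)"
    by (intro linear_intros c)
  show "f (pure_tensor k (tensor k A B) C X c) = g (pure_tensor k (tensor k A B) C X c)"
    by (rule AB.linear_map_ext[OF linear_map_comp[OF f lin] linear_map_comp[OF g lin] X]) (rule eq[OF _ _ c])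
qed

lemma trilinear_assoc:
  "trilinear_map k A B C (tensor k A (tensor k B C))
    (\<lambda>a b c. pure_tensor k A (tensor k B C) a (pure_tensor k B C b c))"
  by (intro trilinear_mapI linear_intros) simp_all

lemma tensor_assoc_hom_left:
  "tensor_assoc k A B C =
    hom_left (tensor k A (tensor k B C)) (\<lambda>a b c. pure_tensor k A (tensor k B C) a (pure_tensor k B C b c))"
  by (simp add: tensor_assoc_def tensor_lift_group)

lemma linear_tensor_assoc:
  "linear_map k (tensor k (tensor k A B) C) (tensor k A (tensor k B C)) (tensor_assoc k A B C)"
  unfolding tensor_assoc_hom_left by (rule linear_hom_left[OF trilinear_assoc A_BC.tensor_module])

lemma tensor_assoc_pure [simp]:
  "a \<in> carrier A \<Longrightarrow> b \<in> carrier B \<Longrightarrow> c \<in> carrier C \<Longrightarrow>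
    tensor_assoc k A B C (pure_tensor k (tensor k A B) C (pure_tensor k A B a b) c) =
    pure_tensor k A (tensor k B C) a (pure_tensor k B C b c)"
  unfolding tensor_assoc_hom_left by (rule hom_left_pure[OF trilinear_assoc A_BC.tensor_module])

lemma hom_right_assoc:
  assumes \<beta>: "trilinear_map k A B C M \<beta>" and M: "module k M"
    and W: "W \<in> carrier (tensor k (tensor k A B) C)"
  shows "hom_right M \<beta> (tensor_assoc k A B C W) = hom_left M \<beta> W"
  by (rule triple_ext[OF _ _ W, where f = "\<lambda>W. hom_right M \<beta> (tensor_assoc k A B C W)" and M = M])
    (simp_all add: linear_map_comp[OF linear_hom_right[OF \<beta> M] linear_tensor_assoc]
      linear_hom_left[OF \<beta> M] hom_left_pure[OF \<beta> M] hom_right_pure[OF \<beta> M])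

end


section \<open>Antipodes of Hopf algebras are anti-multiplicative\<close>

context hopf_algebra
begin

sublocale AA: tensor_pair k A A ..
sublocale AAA: tensor_pair k "tensor k A A" A ..
sublocale A_AA: tensor_pair k A "tensor k A A" ..
sublocale triple: module_triple k A A A ..

abbreviation (input) pure where "pure \<equiv> pure_tensor k A A"

lemma linear_comult: "linear_map k A (tensor2 k A) \<Delta>"
  by (rule algebra_hom_linear[OF comult_hom])

lemmas comult_closed [simp] = linear_map_closed[OF linear_comult]
lemmas linear_comult_comp [linear_intros] = linear_map_comp[OF linear_comult]

lemma linear_antipode: "linear_map k A A s"
  using antipode_closed by (intro linear_mapI) (auto simp: antipode_add antipode_smult)

lemmas s_closed [simp] = linear_map_closed[OF linear_antipode]
lemmas linear_antipode_comp [linear_intros] = linear_map_comp[OF linear_antipode]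

lemma counit_closed [simp]: "x \<in> carrier A \<Longrightarrow> \<epsilon> x \<in> carrier k"
  using counit_hom by (rule ring_hom_closed)

lemma linear_counit [linear_intros]:
  assumes "module k M" "linear_map k C A f" "y \<in> carrier M"
  shows "linear_map k C M (\<lambda>x. \<epsilon> (f x) \<odot>\<^bsub>M\<^esub> y)"
proof -
  interpret M: module k M by fact
  show ?thesis
    using assms ring_hom_add[OF counit_hom]
    by (simp add: linear_map_def counit_linear M.smult_l_distr M.smult_assoc1)
qed

text \<open>Coassociativity in the form \<open>\<Sum> \<beta>(x\<^sub>1\<^sub>1, x\<^sub>1\<^sub>2, x\<^sub>2) = \<Sum> \<beta>(x\<^sub>1, x\<^sub>2\<^sub>1, x\<^sub>2\<^sub>2)\<close> for trilinear \<open>\<beta>\<close>. In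
  applications one side is simplified by the axiom for \<open>\<Delta>(x\<^sub>1)\<close> and the other by the axiom for
  \<open>\<Delta>(x\<^sub>2)\<close>.\<close>

lemma coassoc_hom:
  assumes \<beta>: "trilinear_map k A A A M \<beta>" and M: "module k M" and x: "x \<in> carrier A"
  shows "tensor_hom M (\<lambda>y c. tensor_hom M (\<lambda>a b. \<beta> a b c) (\<Delta> y)) (\<Delta> x) =
    tensor_hom M (\<lambda>a y. tensor_hom M (\<beta> a) (\<Delta> y)) (\<Delta> x)"
proof -
  note left = triple.bilinear_left[OF \<beta> M] and right = triple.bilinear_right[OF \<beta> M]
  have bil: "bilinear_map k A A M (\<lambda>y c. tensor_hom M (\<lambda>a b. \<beta> a b c) (\<Delta> y))"
    "bilinear_map k A A M (\<lambda>a y. tensor_hom M (\<beta> a) (\<Delta> y))"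
    by (intro bilinear_mapI linear_map_comp[OF bilinear_map_left[OF left] linear_comult]
        linear_map_comp[OF bilinear_map_right[OF right] linear_comult]
        bilinear_map_right[OF left] bilinear_map_left[OF right] comult_closed; assumption)+
  have lin: "linear_map k (tensor2 k A) (tensor3 k A) (tensor_map k (tensor2 k A) A \<Delta> id)"
    "linear_map k (tensor2 k A) (tensor k A (tensor2 k A)) (tensor_map k A (tensor2 k A) id \<Delta>)"
    unfolding id_def by (auto intro!: linear_tensor_map linear_comult linear_map_ident simp: AA.T.module_axioms)
  have "tensor_hom M (\<lambda>y c. tensor_hom M (\<lambda>a b. \<beta> a b c) (\<Delta> y)) (\<Delta> x) =
      triple.hom_left M \<beta> (tensor_map k (tensor2 k A) A \<Delta> id (\<Delta> x))"
    by (rule AA.tensor_hom_ext[OF bil(1) M linear_map_comp[OF triple.linear_hom_left[OF \<beta> M] lin(1)], symmetric])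
      (simp_all add: x tensor_map_pure linear_comult linear_map_ident id_def
        AAA.tensor_hom_bilinear_pure[OF left M])
  also have "\<dots> = triple.hom_right M \<beta> (tensor_map k A (tensor2 k A) id \<Delta> (\<Delta> x))"
    using linear_map_closed[OF lin(1)] by (simp add: triple.hom_right_assoc[OF \<beta> M] x flip: coassoc)
  also have "\<dots> = tensor_hom M (\<lambda>a y. tensor_hom M (\<beta> a) (\<Delta> y)) (\<Delta> x)"
    by (rule AA.tensor_hom_ext[OF bil(2) M linear_map_comp[OF triple.linear_hom_right[OF \<beta> M] lin(2)]])
      (simp_all add: x tensor_map_pure linear_comult linear_map_ident id_def
        A_AA.tensor_hom_bilinear_pure[OF right M])
  finally show ?thesis .
qed

lemma counit_left_hom:
  assumes f: "linear_map k A M f" and M: "module k M" and x: "x \<in> carrier A"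
  shows "tensor_hom M (\<lambda>a b. \<epsilon> a \<odot>\<^bsub>M\<^esub> f b) (\<Delta> x) = f x"
proof -
  have bil: "bilinear_map k A A A (\<lambda>a b. \<epsilon> a \<odot>\<^bsub>A\<^esub> b)" "bilinear_map k A A M (\<lambda>a b. \<epsilon> a \<odot>\<^bsub>M\<^esub> f b)"
    by (intro bilinear_mapI linear_intros f; simp add: M linear_map_closed[OF f])+
  have "f x = f (tensor_hom A (\<lambda>a b. \<epsilon> a \<odot>\<^bsub>A\<^esub> b) (\<Delta> x))"
    by (simp add: counit_left x)
  also have "\<dots> = tensor_hom M (\<lambda>a b. f (\<epsilon> a \<odot>\<^bsub>A\<^esub> b)) (\<Delta> x)"
    by (rule AA.linear_map_of_tensor_hom[OF f bil(1)]) (simp_all add: M x)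
  also have "\<dots> = tensor_hom M (\<lambda>a b. \<epsilon> a \<odot>\<^bsub>M\<^esub> f b) (\<Delta> x)"
    by (rule AA.tensor_hom_cong[OF bil(2) M]) (simp_all add: x linear_map_smult[OF f])
  finally show ?thesis by simp
qed

lemma counit_right_hom:
  assumes f: "linear_map k A M f" and M: "module k M" and x: "x \<in> carrier A"
  shows "tensor_hom M (\<lambda>a b. \<epsilon> b \<odot>\<^bsub>M\<^esub> f a) (\<Delta> x) = f x"
proof -
  have bil: "bilinear_map k A A A (\<lambda>a b. \<epsilon> b \<odot>\<^bsub>A\<^esub> a)" "bilinear_map k A A M (\<lambda>a b. \<epsilon> b \<odot>\<^bsub>M\<^esub> f a)"
    by (intro bilinear_mapI linear_intros f; simp add: M linear_map_closed[OF f])+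
  have "f x = f (tensor_hom A (\<lambda>a b. \<epsilon> b \<odot>\<^bsub>A\<^esub> a) (\<Delta> x))"
    by (simp add: counit_right x)
  also have "\<dots> = tensor_hom M (\<lambda>a b. f (\<epsilon> b \<odot>\<^bsub>A\<^esub> a)) (\<Delta> x)"
    by (rule AA.linear_map_of_tensor_hom[OF f bil(1)]) (simp_all add: M x)
  also have "\<dots> = tensor_hom M (\<lambda>a b. \<epsilon> b \<odot>\<^bsub>M\<^esub> f a) (\<Delta> x)"
    by (rule AA.tensor_hom_cong[OF bil(2) M]) (simp_all add: x linear_map_smult[OF f])
  finally show ?thesis by simp
qed

definition antipode_prod where "antipode_prod = tensor_hom A (\<lambda>a b. s a \<otimes>\<^bsub>A\<^esub> b)"

lemma bilinear_antipode_left: "bilinear_map k A A A (\<lambda>a b. s a \<otimes>\<^bsub>A\<^esub> b)"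
  by (intro bilinear_mapI linear_intros) simp_all

lemma bilinear_antipode_right: "bilinear_map k A A A (\<lambda>a b. a \<otimes>\<^bsub>A\<^esub> s b)"
  by (intro bilinear_mapI linear_intros) simp_all

lemma linear_antipode_prod: "linear_map k (tensor2 k A) A antipode_prod"
  unfolding antipode_prod_def by (rule AA.linear_tensor_hom[OF bilinear_antipode_left]) simp

lemmas linear_antipode_prod_comp [linear_intros] = linear_map_comp[OF linear_antipode_prod]
lemmas antipode_prod_closed [simp] = linear_map_closed[OF linear_antipode_prod]

lemma antipode_prod_pure [simp]: "a \<in> carrier A \<Longrightarrow> b \<in> carrier A \<Longrightarrow> antipode_prod (pure a b) = s a \<otimes>\<^bsub>A\<^esub> b"
  unfolding antipode_prod_def by (rule AA.tensor_hom_bilinear_pure[OF bilinear_antipode_left]) simp_all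

lemma antipode_prod_comult: "x \<in> carrier A \<Longrightarrow> antipode_prod (\<Delta> x) = \<epsilon> x \<odot>\<^bsub>A\<^esub> \<one>\<^bsub>A\<^esub>"
  by (simp add: antipode_prod_def antipode_left)

lemma antipode_right_hom:
  assumes f: "linear_map k A M f" and M: "module k M" and x: "x \<in> carrier A"
  shows "tensor_hom M (\<lambda>a b. f (a \<otimes>\<^bsub>A\<^esub> s b)) (\<Delta> x) = \<epsilon> x \<odot>\<^bsub>M\<^esub> f \<one>\<^bsub>A\<^esub>"
  using AA.linear_map_of_tensor_hom[OF f bilinear_antipode_right _ M comult_closed[OF x]]
  by (simp add: antipode_right x linear_map_smult[OF f])

text \<open>In components, \<open>\<Sum> s(x\<^sub>1 y) x\<^sub>2 = \<epsilon>(x) s(y)\<close>. Both sides are values of the sum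
  \<open>\<Sum> s(x\<^sub>1 y\<^sub>1) x\<^sub>2 y\<^sub>2 s(y\<^sub>3)\<close>: contract \<open>y\<^sub>2 s(y\<^sub>3)\<close> to get the left one, and contract
  \<open>s(x\<^sub>1 y\<^sub>1) x\<^sub>2 y\<^sub>2\<close>, which comes from \<open>\<Delta>(x)\<Delta>(y) = \<Delta>(xy)\<close>, to get the right one. The sum over the
  components of \<open>x\<close> stays hidden in \<open>Z = \<Delta>(x)\<close>, so that only \<open>y\<close> has to be split.\<close>

lemma antipode_left_mult:
  assumes x: "x \<in> carrier A" and y: "y \<in> carrier A"
  shows "antipode_prod (\<Delta> x \<otimes>\<^bsub>tensor2 k A\<^esub> pure y \<one>\<^bsub>A\<^esub>) = \<epsilon> x \<odot>\<^bsub>A\<^esub> s y"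
proof -
  define \<beta> where "\<beta> Z a b c = antipode_prod (Z \<otimes>\<^bsub>tensor2 k A\<^esub> pure a b) \<otimes>\<^bsub>A\<^esub> s c" for Z a b c
  have \<beta>: "trilinear_map k A A A A (\<beta> Z)" if "Z \<in> carrier (tensor2 k A)" for Z
    unfolding \<beta>_def by (intro trilinear_mapI linear_intros) (simp_all add: that)
  have left: "tensor_hom A (\<lambda>a b. \<beta> (\<Delta> x) a b c) (\<Delta> z) = \<epsilon> z \<odot>\<^bsub>A\<^esub> (\<epsilon> x \<odot>\<^bsub>A\<^esub> s c)"
    if z: "z \<in> carrier A" and c: "c \<in> carrier A" for z c
  proof -
    have "tensor_hom A (\<lambda>a b. \<beta> (\<Delta> x) a b c) (\<Delta> z) = antipode_prod (\<Delta> x \<otimes>\<^bsub>tensor2 k A\<^esub> \<Delta> z) \<otimes>\<^bsub>A\<^esub> s c"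
      unfolding \<beta>_def
      by (rule AA.tensor_hom_pure_comp[where f = "\<lambda>W. antipode_prod (\<Delta> x \<otimes>\<^bsub>tensor2 k A\<^esub> W) \<otimes>\<^bsub>A\<^esub> s c"])
        (auto intro!: linear_intros simp: x z c)
    also have "\<dots> = antipode_prod (\<Delta> (x \<otimes>\<^bsub>A\<^esub> z)) \<otimes>\<^bsub>A\<^esub> s c"
      by (simp add: algebra_hom_mult[OF comult_hom] x z)
    also have "\<dots> = \<epsilon> z \<odot>\<^bsub>A\<^esub> (\<epsilon> x \<odot>\<^bsub>A\<^esub> s c)"
      by (simp add: antipode_prod_comult x z c ring_hom_mult[OF counit_hom] smult_mult_left R.m_comm flip: smult_assoc1)
    finally show ?thesis .
  qed
  have right: "tensor_hom A (\<beta> Z a) (\<Delta> z) = \<epsilon> z \<odot>\<^bsub>A\<^esub> antipode_prod (Z \<otimes>\<^bsub>tensor2 k A\<^esub> pure a \<one>\<^bsub>A\<^esub>)"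
    if Z: "Z \<in> carrier (tensor2 k A)" and a: "a \<in> carrier A" and z: "z \<in> carrier A" for Z a z
  proof (rule AA.linear_map_ext[OF _ _ Z, where M = A and f = "\<lambda>Z. tensor_hom A (\<beta> Z a) (\<Delta> z)"])
    show "linear_map k (tensor2 k A) A (\<lambda>Z. tensor_hom A (\<beta> Z a) (\<Delta> z))"
      unfolding \<beta>_def by (intro linear_intros bilinear_mapI) (simp_all add: a z)
    show "linear_map k (tensor2 k A) A (\<lambda>Z. \<epsilon> z \<odot>\<^bsub>A\<^esub> antipode_prod (Z \<otimes>\<^bsub>tensor2 k A\<^esub> pure a \<one>\<^bsub>A\<^esub>))"
      by (intro linear_intros) (simp_all add: a z)
    fix p q assume pq: "p \<in> carrier A" "q \<in> carrier A"
    let ?f = "\<lambda>w. s (p \<otimes>\<^bsub>A\<^esub> a) \<otimes>\<^bsub>A\<^esub> q \<otimes>\<^bsub>A\<^esub> w"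
    have f: "linear_map k A A ?f"
      by (intro linear_intros) (simp_all add: pq a)
    have "tensor_hom A (\<beta> (pure p q) a) (\<Delta> z) = tensor_hom A (\<lambda>b c. ?f (b \<otimes>\<^bsub>A\<^esub> s c)) (\<Delta> z)"
      by (rule AA.tensor_hom_cong)
        (auto intro!: bilinear_mapI linear_intros simp: \<beta>_def pq a z m_assoc)
    also have "\<dots> = \<epsilon> z \<odot>\<^bsub>A\<^esub> antipode_prod (pure p q \<otimes>\<^bsub>tensor2 k A\<^esub> pure a \<one>\<^bsub>A\<^esub>)"
      by (simp add: antipode_right_hom[OF f] z pq a)
    finally show "tensor_hom A (\<beta> (pure p q) a) (\<Delta> z) =
        \<epsilon> z \<odot>\<^bsub>A\<^esub> antipode_prod (pure p q \<otimes>\<^bsub>tensor2 k A\<^esub> pure a \<one>\<^bsub>A\<^esub>)" .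
  qed
  have "antipode_prod (\<Delta> x \<otimes>\<^bsub>tensor2 k A\<^esub> pure y \<one>\<^bsub>A\<^esub>) =
      tensor_hom A (\<lambda>a z. \<epsilon> z \<odot>\<^bsub>A\<^esub> antipode_prod (\<Delta> x \<otimes>\<^bsub>tensor2 k A\<^esub> pure a \<one>\<^bsub>A\<^esub>)) (\<Delta> y)"
    by (rule counit_right_hom[symmetric, where f = "\<lambda>a. antipode_prod (\<Delta> x \<otimes>\<^bsub>tensor2 k A\<^esub> pure a \<one>\<^bsub>A\<^esub>)"])
      (auto intro!: linear_intros simp: x y)
  also have "\<dots> = tensor_hom A (\<lambda>a z. tensor_hom A (\<beta> (\<Delta> x) a) (\<Delta> z)) (\<Delta> y)"
    by (rule AA.tensor_hom_cong[symmetric]) (auto intro!: bilinear_mapI linear_intros simp: right x y)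
  also have "\<dots> = tensor_hom A (\<lambda>z c. tensor_hom A (\<lambda>a b. \<beta> (\<Delta> x) a b c) (\<Delta> z)) (\<Delta> y)"
    by (rule coassoc_hom[symmetric]) (simp_all add: \<beta> x y)
  also have "\<dots> = tensor_hom A (\<lambda>z c. \<epsilon> z \<odot>\<^bsub>A\<^esub> (\<epsilon> x \<odot>\<^bsub>A\<^esub> s c)) (\<Delta> y)"
    by (rule AA.tensor_hom_cong) (auto intro!: bilinear_mapI linear_intros simp: left x y)
  also have "\<dots> = \<epsilon> x \<odot>\<^bsub>A\<^esub> s y"
    by (rule counit_left_hom[where f = "\<lambda>c. \<epsilon> x \<odot>\<^bsub>A\<^esub> s c"]) (auto intro!: linear_intros simp: x y)
  finally show ?thesis .
qed

text \<open>The sum \<open>\<Sum> s(x\<^sub>1 y) x\<^sub>2 s(x\<^sub>3)\<close> is \<open>s(xy)\<close> if \<open>x\<^sub>2 s(x\<^sub>3)\<close> is contracted, and \<open>s(y) s(x)\<close> if the previous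
  lemma is applied to \<open>s(x\<^sub>1 y) x\<^sub>2\<close>.\<close>

lemma antipode_mult:
  assumes x: "x \<in> carrier A" and y: "y \<in> carrier A"
  shows "s (x \<otimes>\<^bsub>A\<^esub> y) = s y \<otimes>\<^bsub>A\<^esub> s x"
proof -
  define \<beta> where "\<beta> a b c = s (a \<otimes>\<^bsub>A\<^esub> y) \<otimes>\<^bsub>A\<^esub> b \<otimes>\<^bsub>A\<^esub> s c" for a b c
  have \<beta>: "trilinear_map k A A A A \<beta>"
    unfolding \<beta>_def by (intro trilinear_mapI linear_intros) (simp_all add: y)
  have left: "tensor_hom A (\<lambda>a b. \<beta> a b c) (\<Delta> z) = \<epsilon> z \<odot>\<^bsub>A\<^esub> (s y \<otimes>\<^bsub>A\<^esub> s c)"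
    if z: "z \<in> carrier A" and c: "c \<in> carrier A" for z c
  proof -
    have "tensor_hom A (\<lambda>a b. \<beta> a b c) (\<Delta> z) = antipode_prod (\<Delta> z \<otimes>\<^bsub>tensor2 k A\<^esub> pure y \<one>\<^bsub>A\<^esub>) \<otimes>\<^bsub>A\<^esub> s c"
      by (rule AA.tensor_hom_ext[symmetric, where f = "\<lambda>W. antipode_prod (W \<otimes>\<^bsub>tensor2 k A\<^esub> pure y \<one>\<^bsub>A\<^esub>) \<otimes>\<^bsub>A\<^esub> s c"])
        (auto intro!: bilinear_mapI linear_intros simp: z c y \<beta>_def)
    then show ?thesis
      by (simp add: antipode_left_mult smult_mult_left z c y)
  qed
  have right: "tensor_hom A (\<beta> a) (\<Delta> z) = \<epsilon> z \<odot>\<^bsub>A\<^esub> s (a \<otimes>\<^bsub>A\<^esub> y)"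
    if a: "a \<in> carrier A" and z: "z \<in> carrier A" for a z
  proof -
    let ?f = "\<lambda>w. s (a \<otimes>\<^bsub>A\<^esub> y) \<otimes>\<^bsub>A\<^esub> w"
    have f: "linear_map k A A ?f"
      by (intro linear_intros) (simp_all add: y a)
    have "tensor_hom A (\<beta> a) (\<Delta> z) = tensor_hom A (\<lambda>b c. ?f (b \<otimes>\<^bsub>A\<^esub> s c)) (\<Delta> z)"
      by (rule AA.tensor_hom_cong) (auto intro!: bilinear_mapI linear_intros simp: \<beta>_def a y z m_assoc)
    then show ?thesis
      by (simp add: antipode_right_hom[OF f] z y a)
  qed
  have "s (x \<otimes>\<^bsub>A\<^esub> y) = tensor_hom A (\<lambda>a z. \<epsilon> z \<odot>\<^bsub>A\<^esub> s (a \<otimes>\<^bsub>A\<^esub> y)) (\<Delta> x)"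
    by (rule counit_right_hom[symmetric, where f = "\<lambda>a. s (a \<otimes>\<^bsub>A\<^esub> y)"])
      (auto intro!: linear_intros simp: x y)
  also have "\<dots> = tensor_hom A (\<lambda>a z. tensor_hom A (\<beta> a) (\<Delta> z)) (\<Delta> x)"
    by (rule AA.tensor_hom_cong[symmetric]) (auto intro!: bilinear_mapI linear_intros simp: right x y)
  also have "\<dots> = tensor_hom A (\<lambda>z c. tensor_hom A (\<lambda>a b. \<beta> a b c) (\<Delta> z)) (\<Delta> x)"
    by (rule coassoc_hom[symmetric]) (simp_all add: \<beta> x)
  also have "\<dots> = tensor_hom A (\<lambda>z c. \<epsilon> z \<odot>\<^bsub>A\<^esub> (s y \<otimes>\<^bsub>A\<^esub> s c)) (\<Delta> x)"
    by (rule AA.tensor_hom_cong) (auto intro!: bilinear_mapI linear_intros simp: left x y)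
  also have "\<dots> = s y \<otimes>\<^bsub>A\<^esub> s x"
    by (rule counit_left_hom[where f = "\<lambda>c. s y \<otimes>\<^bsub>A\<^esub> s c"]) (auto intro!: linear_intros simp: x y)
  finally show ?thesis .
qed

lemma antipode_one: "s \<one>\<^bsub>A\<^esub> = \<one>\<^bsub>A\<^esub>"
  using antipode_prod_comult[of "\<one>\<^bsub>A\<^esub>"] ring_hom_one[OF counit_hom]
  by (simp add: algebra_hom_one[OF comult_hom] AA.one_tensor)

lemma antipode_hom: "s \<in> algebra_hom k A (opposite A)"
  by (rule algebra_homI) (simp_all add: linear_antipode antipode_mult antipode_one)

end


section \<open>Universal R-matrices\<close>

context hopf_algebra
begin

abbreviation (input) pure3 where "pure3 \<equiv> pure_tensor k (tensor2 k A) A"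
abbreviation (input) pure3' where "pure3' \<equiv> pure_tensor k A (tensor2 k A)"

lemma one_left_hom: "(\<lambda>a. pure a \<one>\<^bsub>A\<^esub>) \<in> algebra_hom k A (tensor2 k A)"
  and one_right_hom: "(\<lambda>a. pure \<one>\<^bsub>A\<^esub> a) \<in> algebra_hom k A (tensor2 k A)"
  by (rule algebra_homI; (intro linear_intros)?; simp add: AA.one_tensor)+

lemma place13_hom: "place13 k A \<in> algebra_hom k (tensor2 k A) (tensor3 k A)"
  and place23_hom: "place23 k A \<in> algebra_hom k (tensor2 k A) (tensor3 k A)"
  unfolding place13_def place23_def
  by (rule tensor_map_algebra_hom; simp add: one_left_hom one_right_hom algebra_hom_ident)+

lemma place13_pure [simp]:
  "a \<in> carrier A \<Longrightarrow> b \<in> carrier A \<Longrightarrow> place13 k A (pure a b) = pure3 (pure a \<one>\<^bsub>A\<^esub>) b"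
  and place23_pure [simp]:
  "a \<in> carrier A \<Longrightarrow> b \<in> carrier A \<Longrightarrow> place23 k A (pure a b) = pure3 (pure \<one>\<^bsub>A\<^esub> a) b"
  unfolding place13_def place23_def
  by (simp_all add: tensor_map_pure algebra_hom_linear[OF one_left_hom] algebra_hom_linear[OF one_right_hom]
      linear_map_ident)

lemma linear_place12: "linear_map k (tensor2 k A) (tensor3 k A) (place12 k A)"
  unfolding place12_def by (intro linear_intros) simp

lemma linear_flip: "linear_map k (tensor2 k A) (tensor2 k A) (tensor_flip k A A)"
  and flip_pure [simp]: "a \<in> carrier A \<Longrightarrow> b \<in> carrier A \<Longrightarrow> tensor_flip k A A (pure a b) = pure b a"
proof -
  have "bilinear_map k A A (tensor2 k A) (\<lambda>a b. pure b a)"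
    by (intro bilinear_mapI linear_intros)
  note bil = this AA.tensor_module
  show "linear_map k (tensor2 k A) (tensor2 k A) (tensor_flip k A A)"
    unfolding tensor_flip_def tensor_lift_group by (rule AA.linear_tensor_hom[OF bil])
  show "tensor_flip k A A (pure a b) = pure b a" if "a \<in> carrier A" "b \<in> carrier A"
    unfolding tensor_flip_def tensor_lift_group using that by (rule AA.tensor_hom_bilinear_pure[OF bil])
qed

lemma flip_hom: "tensor_flip k A A \<in> algebra_hom k (tensor2 k A) (tensor2 k A)"
  by (rule AA.algebra_hom_tensorI) (simp_all add: linear_flip AA.one_tensor)

lemmas linear_place [linear_intros] =
  linear_map_comp[OF algebra_hom_linear[OF place13_hom]]
  linear_map_comp[OF algebra_hom_linear[OF place23_hom]]
  linear_map_comp[OF linear_place12] linear_map_comp[OF linear_flip]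

lemmas place_closed [simp] =
  linear_map_closed[OF algebra_hom_linear[OF place13_hom]]
  linear_map_closed[OF algebra_hom_linear[OF place23_hom]]
  linear_map_closed[OF linear_place12] linear_map_closed[OF linear_flip]

definition counit_l where "counit_l = tensor_hom A (\<lambda>a b. \<epsilon> a \<odot>\<^bsub>A\<^esub> b)"
definition counit_r where "counit_r = tensor_hom A (\<lambda>a b. \<epsilon> b \<odot>\<^bsub>A\<^esub> a)"

lemma bilinear_counit:
  "bilinear_map k A A A (\<lambda>a b. \<epsilon> a \<odot>\<^bsub>A\<^esub> b)" "bilinear_map k A A A (\<lambda>a b. \<epsilon> b \<odot>\<^bsub>A\<^esub> a)"
  by (intro bilinear_mapI linear_intros; simp)+

lemma linear_counit_l: "linear_map k (tensor2 k A) A counit_l"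
  and linear_counit_r: "linear_map k (tensor2 k A) A counit_r"
  unfolding counit_l_def counit_r_def by (intro AA.linear_tensor_hom bilinear_counit module_axioms)+

lemmas linear_counit_comp [linear_intros] =
  linear_map_comp[OF linear_counit_l] linear_map_comp[OF linear_counit_r]

lemmas counit_lr_closed [simp] = linear_map_closed[OF linear_counit_l] linear_map_closed[OF linear_counit_r]

lemma counit_l_pure [simp]: "a \<in> carrier A \<Longrightarrow> b \<in> carrier A \<Longrightarrow> counit_l (pure a b) = \<epsilon> a \<odot>\<^bsub>A\<^esub> b"
  and counit_r_pure [simp]: "a \<in> carrier A \<Longrightarrow> b \<in> carrier A \<Longrightarrow> counit_r (pure a b) = \<epsilon> b \<odot>\<^bsub>A\<^esub> a"
  unfolding counit_l_def counit_r_def by (simp_all add: AA.tensor_hom_bilinear_pure bilinear_counit)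

lemma counit_l_comult [simp]: "x \<in> carrier A \<Longrightarrow> counit_l (\<Delta> x) = x"
  by (simp add: counit_l_def counit_left)

lemma counit_one [simp]: "\<epsilon> \<one>\<^bsub>A\<^esub> = \<one>\<^bsub>k\<^esub>"
  by (rule ring_hom_one[OF counit_hom])

lemma linear_tensor_antipode:
  "linear_map k (tensor2 k A) (tensor2 k A) (tensor_map k A A s (\<lambda>x. x))"
  "linear_map k (tensor2 k A) (tensor2 k A) (tensor_map k A A (\<lambda>x. x) s)"
  "linear_map k (tensor2 k A) (tensor2 k A) (tensor_map k A A s s)"
  by (simp_all add: linear_tensor_map linear_antipode linear_map_ident)

lemma tensor_antipode_pure [simp]:
  assumes "a \<in> carrier A" "b \<in> carrier A"
  shows "tensor_map k A A s (\<lambda>x. x) (pure a b) = pure (s a) b"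
    "tensor_map k A A (\<lambda>x. x) s (pure a b) = pure a (s b)"
    "tensor_map k A A s s (pure a b) = pure (s a) (s b)"
  using assms by (simp_all add: tensor_map_pure linear_antipode linear_map_ident)

lemmas linear_tensor_antipode_comp [linear_intros] = linear_tensor_antipode[THEN linear_map_comp]
lemmas tensor_antipode_closed [simp] = linear_tensor_antipode[THEN linear_map_closed]

end

context quasitriangular_hopf_algebra
begin

lemma R_closed [simp]: "R \<in> carrier (tensor2 k A)"
  using R_invertible by (rule AA.T.Units_closed)

lemma inv_R_closed [simp]: "inv\<^bsub>tensor2 k A\<^esub> R \<in> carrier (tensor2 k A)"
  using R_invertible by (rule AA.T.Units_inv_closed)

lemma R_cancel:
  assumes E: "E \<in> carrier (tensor2 k A)"
  shows "E \<otimes>\<^bsub>tensor2 k A\<^esub> R = R \<Longrightarrow> E = \<one>\<^bsub>tensor2 k A\<^esub>" "R \<otimes>\<^bsub>tensor2 k A\<^esub> E = R \<Longrightarrow> E = \<one>\<^bsub>tensor2 k A\<^esub>"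
proof -
  assume "E \<otimes>\<^bsub>tensor2 k A\<^esub> R = R"
  then have "E \<otimes>\<^bsub>tensor2 k A\<^esub> (R \<otimes>\<^bsub>tensor2 k A\<^esub> inv\<^bsub>tensor2 k A\<^esub> R) = R \<otimes>\<^bsub>tensor2 k A\<^esub> inv\<^bsub>tensor2 k A\<^esub> R"
    using E by (simp flip: AA.T.m_assoc del: AA.T.Units_r_inv)
  then show "E = \<one>\<^bsub>tensor2 k A\<^esub>"
    using E R_invertible by simp
next
  assume "R \<otimes>\<^bsub>tensor2 k A\<^esub> E = R"
  then show "E = \<one>\<^bsub>tensor2 k A\<^esub>"
    using E R_invertible AA.T.Units_l_cancel[of R E "\<one>\<^bsub>tensor2 k A\<^esub>"] by simp
qed

lemma linear_comult_left: "linear_map k (tensor2 k A) (tensor3 k A) (tensor_map k (tensor2 k A) A \<Delta> id)"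
  and linear_comult_right: "linear_map k (tensor2 k A) (tensor k A (tensor2 k A)) (tensor_map k A (tensor2 k A) id \<Delta>)"
  unfolding id_def by (auto intro!: linear_tensor_map linear_comult linear_map_ident)

lemma comult_left_pure:
  "a \<in> carrier A \<Longrightarrow> b \<in> carrier A \<Longrightarrow> tensor_map k (tensor2 k A) A \<Delta> id (pure a b) = pure3 (\<Delta> a) b"
  and comult_right_pure:
  "a \<in> carrier A \<Longrightarrow> b \<in> carrier A \<Longrightarrow> tensor_map k A (tensor2 k A) id \<Delta> (pure a b) = pure3' a (\<Delta> b)"
  by (simp_all add: id_def tensor_map_pure linear_comult linear_map_ident)

definition contract_l where "contract_l f = tensor_map k A A f (\<lambda>x. x)"
definition contract_r where "contract_r f = tensor_map k A A (\<lambda>x. x) f"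

lemma linear_contract:
  assumes "linear_map k (tensor2 k A) A f"
  shows "linear_map k (tensor3 k A) (tensor2 k A) (contract_l f)"
    and "linear_map k (tensor k A (tensor2 k A)) (tensor2 k A) (contract_r f)"
  using assms by (auto simp: contract_l_def contract_r_def intro!: linear_tensor_map linear_map_ident)

lemma contract_pure:
  assumes "linear_map k (tensor2 k A) A f" "X \<in> carrier (tensor2 k A)" "c \<in> carrier A"
  shows "contract_l f (pure3 X c) = pure (f X) c" "contract_r f (pure3' c X) = pure c (f X)"
  using assms by (simp_all add: contract_l_def contract_r_def tensor_map_pure linear_map_ident)

text \<open>The left-hand side equals \<open>(f \<otimes> 1)(R\<^sub>1\<^sub>3R\<^sub>2\<^sub>3)\<close>. Generalised to independent tensors in the two
  places this is bilinear, so the value is determined by the behaviour of \<open>f\<close> on pure tensors. With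
  the counit and the antipode as \<open>f\<close>, the left-hand side can also be evaluated directly.\<close>

lemma contract_l_R:
  assumes f: "linear_map k (tensor2 k A) A f"
    and g: "linear_map k (tensor2 k A) (tensor2 k A) g"
    and bil: "\<And>a b a' b'. a \<in> carrier A \<Longrightarrow> b \<in> carrier A \<Longrightarrow> a' \<in> carrier A \<Longrightarrow> b' \<in> carrier A \<Longrightarrow>
      pure (f (pure a a')) (b \<otimes>\<^bsub>A\<^esub> b') = g (pure a b) \<otimes>\<^bsub>tensor2 k A\<^esub> pure a' b'"
  shows "contract_l f (tensor_map k (tensor2 k A) A \<Delta> id R) = g R \<otimes>\<^bsub>tensor2 k A\<^esub> R"
proof -
  note lin = linear_contract(1)[OF f] and gc = linear_map_closed[OF g]
  have "contract_l f (place13 k A X \<otimes>\<^bsub>tensor3 k A\<^esub> place23 k A Y) = g X \<otimes>\<^bsub>tensor2 k A\<^esub> Y"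
    if X: "X \<in> carrier (tensor2 k A)" and Y: "Y \<in> carrier (tensor2 k A)" for X Y
  proof (rule AA.linear_map_ext[OF _ _ X, where M = "tensor2 k A"])
    show "linear_map k (tensor2 k A) (tensor2 k A) (\<lambda>X. contract_l f (place13 k A X \<otimes>\<^bsub>tensor3 k A\<^esub> place23 k A Y))"
      "linear_map k (tensor2 k A) (tensor2 k A) (\<lambda>X. g X \<otimes>\<^bsub>tensor2 k A\<^esub> Y)"
      by (intro linear_map_comp[OF lin] linear_map_comp[OF g] linear_intros; simp add: Y)+
    fix a b assume ab: "a \<in> carrier A" "b \<in> carrier A"
    show "contract_l f (place13 k A (pure a b) \<otimes>\<^bsub>tensor3 k A\<^esub> place23 k A Y) = g (pure a b) \<otimes>\<^bsub>tensor2 k A\<^esub> Y"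
    proof (rule AA.linear_map_ext[OF _ _ Y, where M = "tensor2 k A"])
      show "linear_map k (tensor2 k A) (tensor2 k A)
          (\<lambda>Y. contract_l f (place13 k A (pure a b) \<otimes>\<^bsub>tensor3 k A\<^esub> place23 k A Y))"
        "linear_map k (tensor2 k A) (tensor2 k A) (\<lambda>Y. g (pure a b) \<otimes>\<^bsub>tensor2 k A\<^esub> Y)"
        by (intro linear_map_comp[OF lin] linear_intros; simp add: ab gc)+
    qed (simp add: ab contract_pure[OF f] bil)
  qed
  then show ?thesis
    by (simp add: R_comult_left)
qed

text \<open>The same for \<open>(1 \<otimes> f)(R\<^sub>1\<^sub>3R\<^sub>1\<^sub>2)\<close>. The result is left as a general bilinear expression in \<open>R\<close> and \<open>R\<close>,
  because for the antipode it is a product in \<open>A \<otimes> A\<^sup>o\<^sup>p\<close> and not in \<open>A \<otimes> A\<close>.\<close>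

lemma contract_r_R:
  assumes f: "linear_map k (tensor2 k A) A f"
    and m: "bilinear_map k (tensor2 k A) (tensor2 k A) (tensor2 k A) m"
    and bil: "\<And>a b a' b'. a \<in> carrier A \<Longrightarrow> b \<in> carrier A \<Longrightarrow> a' \<in> carrier A \<Longrightarrow> b' \<in> carrier A \<Longrightarrow>
      pure (a \<otimes>\<^bsub>A\<^esub> a') (f (pure b' b)) = m (pure a b) (pure a' b')"
  shows "contract_r f (tensor_map k A (tensor2 k A) id \<Delta> R) = m R R"
proof -
  note lin = linear_map_comp[OF linear_contract(2)[OF f] triple.linear_tensor_assoc]
  let ?c = "\<lambda>W. contract_r f (tensor_assoc k A A A W)"
  have "?c (place13 k A X \<otimes>\<^bsub>tensor3 k A\<^esub> place12 k A Y) = m X Y"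
    if X: "X \<in> carrier (tensor2 k A)" and Y: "Y \<in> carrier (tensor2 k A)" for X Y
  proof (rule AA.linear_map_ext[OF _ _ X, where M = "tensor2 k A"])
    show "linear_map k (tensor2 k A) (tensor2 k A) (\<lambda>X. ?c (place13 k A X \<otimes>\<^bsub>tensor3 k A\<^esub> place12 k A Y))"
      by (intro linear_map_comp[OF lin] linear_intros; simp add: Y)
    show "linear_map k (tensor2 k A) (tensor2 k A) (\<lambda>X. m X Y)"
      by (rule bilinear_map_left[OF m Y])
    fix a b assume ab: "a \<in> carrier A" "b \<in> carrier A"
    show "?c (place13 k A (pure a b) \<otimes>\<^bsub>tensor3 k A\<^esub> place12 k A Y) = m (pure a b) Y"
    proof (rule AA.linear_map_ext[OF _ _ Y, where M = "tensor2 k A"])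
      show "linear_map k (tensor2 k A) (tensor2 k A)
          (\<lambda>Y. ?c (place13 k A (pure a b) \<otimes>\<^bsub>tensor3 k A\<^esub> place12 k A Y))"
        by (intro linear_map_comp[OF lin] linear_intros; simp add: ab)
      show "linear_map k (tensor2 k A) (tensor2 k A) (\<lambda>Y. m (pure a b) Y)"
        by (rule bilinear_map_right[OF m]) (simp add: ab)
    qed (simp add: ab contract_pure[OF f] bil place12_def)
  qed
  then show ?thesis
    by (simp add: R_comult_right)
qed

lemma contract_l_comult:
  assumes f: "linear_map k (tensor2 k A) A f" and g: "linear_map k (tensor2 k A) (tensor2 k A) g"
    and "\<And>a b. a \<in> carrier A \<Longrightarrow> b \<in> carrier A \<Longrightarrow> pure (f (\<Delta> a)) b = g (pure a b)"
  shows "contract_l f (tensor_map k (tensor2 k A) A \<Delta> id R) = g R"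
  using assms
  by (intro AA.linear_map_ext[OF linear_map_comp[OF linear_contract(1)[OF f] linear_comult_left] g R_closed])
    (simp add: comult_left_pure contract_pure)

lemma contract_r_comult:
  assumes f: "linear_map k (tensor2 k A) A f" and g: "linear_map k (tensor2 k A) (tensor2 k A) g"
    and "\<And>a b. a \<in> carrier A \<Longrightarrow> b \<in> carrier A \<Longrightarrow> pure a (f (\<Delta> b)) = g (pure a b)"
  shows "contract_r f (tensor_map k A (tensor2 k A) id \<Delta> R) = g R"
  using assms
  by (intro AA.linear_map_ext[OF linear_map_comp[OF linear_contract(2)[OF f] linear_comult_right] g R_closed])
    (simp add: comult_right_pure contract_pure)

text \<open>Contracting \<open>(\<Delta> \<otimes> 1)R\<close> with the counit gives \<open>R = (1 \<otimes> c)R\<close> for \<open>c = (\<epsilon> \<otimes> 1)R\<close>, and \<open>R\<close> can be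
  cancelled.\<close>

lemma counit_l_R: "counit_l R = \<one>\<^bsub>A\<^esub>"
proof -
  have "R = pure \<one>\<^bsub>A\<^esub> (counit_l R) \<otimes>\<^bsub>tensor2 k A\<^esub> R"
  proof -
    have "contract_l counit_l (tensor_map k (tensor2 k A) A \<Delta> id R) = R"
      by (rule contract_l_comult[where g = "\<lambda>X. X"]) (simp_all add: linear_counit_l linear_map_ident)
    moreover have "contract_l counit_l (tensor_map k (tensor2 k A) A \<Delta> id R) =
        pure \<one>\<^bsub>A\<^esub> (counit_l R) \<otimes>\<^bsub>tensor2 k A\<^esub> R"
      by (rule contract_l_R[where g = "\<lambda>X. pure \<one>\<^bsub>A\<^esub> (counit_l X)"], rule linear_counit_l, intro linear_intros)
        (simp_all add: smult_mult_left AA.pure_smult_left_right)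
    ultimately show ?thesis by simp
  qed
  then have "pure \<one>\<^bsub>A\<^esub> (counit_l R) = \<one>\<^bsub>tensor2 k A\<^esub>"
    by (intro R_cancel(1)) simp_all
  then have "counit_l (pure \<one>\<^bsub>A\<^esub> (counit_l R)) = counit_l (pure \<one>\<^bsub>A\<^esub> \<one>\<^bsub>A\<^esub>)"
    by (simp only: AA.one_tensor)
  then show ?thesis by simp
qed

lemma counit_r_R: "counit_r R = \<one>\<^bsub>A\<^esub>"
proof -
  have "R = R \<otimes>\<^bsub>tensor2 k A\<^esub> pure (counit_r R) \<one>\<^bsub>A\<^esub>"
  proof -
    have "contract_r counit_l (tensor_map k A (tensor2 k A) id \<Delta> R) = R"
      by (rule contract_r_comult[where g = "\<lambda>X. X"]) (simp_all add: linear_counit_l linear_map_ident)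
    moreover have "contract_r counit_l (tensor_map k A (tensor2 k A) id \<Delta> R) =
        R \<otimes>\<^bsub>tensor2 k A\<^esub> pure (counit_r R) \<one>\<^bsub>A\<^esub>"
      by (rule contract_r_R[where m = "\<lambda>X Y. X \<otimes>\<^bsub>tensor2 k A\<^esub> pure (counit_r Y) \<one>\<^bsub>A\<^esub>"], rule linear_counit_l,
          intro bilinear_mapI linear_intros)
        (simp_all add: smult_mult_right AA.pure_smult_left_right)
    ultimately show ?thesis by simp
  qed
  then have "pure (counit_r R) \<one>\<^bsub>A\<^esub> = \<one>\<^bsub>tensor2 k A\<^esub>"
    by (intro R_cancel(2)) simp_all
  then have "counit_r (pure (counit_r R) \<one>\<^bsub>A\<^esub>) = counit_r (pure \<one>\<^bsub>A\<^esub> \<one>\<^bsub>A\<^esub>)"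
    by (simp only: AA.one_tensor)
  then show ?thesis by simp
qed

text \<open>Contracting \<open>(\<Delta> \<otimes> 1)R\<close> with \<open>a \<otimes> b \<mapsto> s(a)b\<close> shows that \<open>(s \<otimes> 1)R\<close> is a left inverse of \<open>R\<close>.\<close>

lemma antipode_left_R: "tensor_map k A A s (\<lambda>x. x) R = inv\<^bsub>tensor2 k A\<^esub> R"
proof -
  let ?sR = "tensor_map k A A s (\<lambda>x. x) R"
  have "contract_l antipode_prod (tensor_map k (tensor2 k A) A \<Delta> id R) = pure \<one>\<^bsub>A\<^esub> (counit_l R)"
    by (rule contract_l_comult[where g = "\<lambda>X. pure \<one>\<^bsub>A\<^esub> (counit_l X)"], rule linear_antipode_prod, intro linear_intros)
      (simp_all add: antipode_prod_comult AA.pure_smult_left_right)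
  moreover have "contract_l antipode_prod (tensor_map k (tensor2 k A) A \<Delta> id R) = ?sR \<otimes>\<^bsub>tensor2 k A\<^esub> R"
    by (rule contract_l_R) (simp_all add: linear_antipode_prod linear_tensor_antipode)
  ultimately have "?sR \<otimes>\<^bsub>tensor2 k A\<^esub> R = \<one>\<^bsub>tensor2 k A\<^esub>"
    by (simp add: counit_l_R AA.one_tensor)
  then have "?sR \<otimes>\<^bsub>tensor2 k A\<^esub> (R \<otimes>\<^bsub>tensor2 k A\<^esub> inv\<^bsub>tensor2 k A\<^esub> R) = inv\<^bsub>tensor2 k A\<^esub> R"
    by (simp flip: AA.T.m_assoc del: AA.T.Units_r_inv)
  then show ?thesis
    using R_invertible by simp
qed

interpretation AAop: tensor_pair k A "opposite A"
  by (simp add: tensor_pair_def opposite_k_algebra)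

text \<open>Contracting \<open>(1 \<otimes> \<Delta>)R\<close> with \<open>a \<otimes> b \<mapsto> s(a)b\<close> shows that \<open>R\<close> is a left inverse of \<open>(1 \<otimes> s)R\<close> in
  \<open>A \<otimes> A\<^sup>o\<^sup>p\<close>. As \<open>1 \<otimes> s\<close> is a homomorphism into that algebra, \<open>(1 \<otimes> s)R\<inverse>\<close> is a right inverse of
  the same element, and the two inverses agree. Bijectivity of \<open>s\<close> is not yet known at this point,
  hence the formulation without \<open>s\<inverse>\<close>.\<close>

lemma antipode_right_inv_R: "tensor_map k A A (\<lambda>x. x) s (inv\<^bsub>tensor2 k A\<^esub> R) = R"
proof -
  let ?op = "tensor k A (opposite A)"
  let ?\<psi> = "tensor_map k A A (\<lambda>x. x) s"
  have \<psi>: "?\<psi> \<in> algebra_hom k (tensor2 k A) ?op"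
    using tensor_map_algebra_hom[OF algebra_hom_ident antipode_hom, of A]
    by (simp add: tensor_map_opposite opposite_k_algebra)
  have bil: "bilinear_map k (tensor2 k A) (tensor2 k A) (tensor2 k A) (\<lambda>X Y. X \<otimes>\<^bsub>?op\<^esub> ?\<psi> Y)"
  proof -
    have *: "linear_map k (tensor2 k A) (tensor2 k A) = linear_map k ?op ?op"
      "linear_map k ?op (tensor2 k A) = linear_map k ?op ?op"
      "linear_map k (tensor2 k A) ?op = linear_map k ?op ?op"
      by (simp_all add: fun_eq_iff linear_map_def tensor_opposite_simps)
    have \<psi>': "linear_map k ?op ?op ?\<psi>"
      using linear_tensor_antipode(2) by (simp only: *)
    show ?thesis
      by (rule bilinear_mapI; unfold *; intro linear_map_comp[OF \<psi>'] linear_intros)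
        (simp_all add: tensor_opposite_simps linear_map_closed[OF \<psi>', unfolded tensor_opposite_simps])
  qed
  have "contract_r antipode_prod (tensor_map k A (tensor2 k A) id \<Delta> R) = pure (counit_r R) \<one>\<^bsub>A\<^esub>"
    by (rule contract_r_comult[where g = "\<lambda>X. pure (counit_r X) \<one>\<^bsub>A\<^esub>"], rule linear_antipode_prod, intro linear_intros)
      (simp_all add: antipode_prod_comult AA.pure_smult_left_right)
  moreover have "contract_r antipode_prod (tensor_map k A (tensor2 k A) id \<Delta> R) = R \<otimes>\<^bsub>?op\<^esub> ?\<psi> R"
    by (rule contract_r_R[where m = "\<lambda>X Y. X \<otimes>\<^bsub>?op\<^esub> ?\<psi> Y", OF linear_antipode_prod bil])
      (use AAop.mult_pure in \<open>simp add: pure_tensor_opposite\<close>)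
  ultimately have R\<psi>: "R \<otimes>\<^bsub>?op\<^esub> ?\<psi> R = \<one>\<^bsub>?op\<^esub>"
    by (simp add: counit_r_R AA.one_tensor tensor_opposite_simps)
  have \<psi>\<psi>: "?\<psi> R \<otimes>\<^bsub>?op\<^esub> ?\<psi> (inv\<^bsub>tensor2 k A\<^esub> R) = \<one>\<^bsub>?op\<^esub>"
    using R_invertible by (simp add: algebra_hom_one[OF \<psi>] flip: algebra_hom_mult[OF \<psi>])
  have "R \<otimes>\<^bsub>?op\<^esub> ?\<psi> R \<otimes>\<^bsub>?op\<^esub> ?\<psi> (inv\<^bsub>tensor2 k A\<^esub> R) = R \<otimes>\<^bsub>?op\<^esub> (?\<psi> R \<otimes>\<^bsub>?op\<^esub> ?\<psi> (inv\<^bsub>tensor2 k A\<^esub> R))"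
    by (rule AAop.T.m_assoc) (simp_all add: tensor_opposite_simps)
  then show ?thesis
    by (simp add: R\<psi> \<psi>\<psi> AAop.T.l_one[unfolded tensor_opposite_simps]
        AAop.T.r_one[unfolded tensor_opposite_simps] tensor_opposite_simps)
qed

lemma antipode_antipode_R: "tensor_map k A A s s R = R"
proof -
  have "tensor_map k A A s s R = tensor_map k A A (\<lambda>x. x) s (tensor_map k A A s (\<lambda>x. x) R)"
    by (rule tensor_map_comp[where A = A and B = A and C = A and D = A, symmetric])
      (simp_all add: linear_antipode linear_map_ident)
  then show ?thesis
    by (simp add: antipode_left_R antipode_right_inv_R)
qed

end


section \<open>The Drinfeld element and the square of the antipode\<close>

context hopf_algebra
begin

abbreviation (input) drinfeld where "drinfeld \<equiv> drinfeld_element A s"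

lemma bilinear_drinfeld: "bilinear_map k A A A (\<lambda>a b. s b \<otimes>\<^bsub>A\<^esub> a)"
  by (intro bilinear_mapI linear_intros; simp)

lemma linear_drinfeld: "linear_map k (tensor2 k A) A drinfeld"
proof -
  have "drinfeld = tensor_hom A (\<lambda>a b. s b \<otimes>\<^bsub>A\<^esub> a)"
    by (simp add: fun_eq_iff drinfeld_element_def)
  then show ?thesis
    using AA.linear_tensor_hom[OF bilinear_drinfeld module_axioms] by simp
qed

lemmas linear_drinfeld_comp [linear_intros] = linear_map_comp[OF linear_drinfeld]
lemmas drinfeld_closed [simp] = linear_map_closed[OF linear_drinfeld]

lemma drinfeld_pure [simp]:
  "a \<in> carrier A \<Longrightarrow> b \<in> carrier A \<Longrightarrow> drinfeld (pure a b) = s b \<otimes>\<^bsub>A\<^esub> a"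
  by (simp add: drinfeld_element_def AA.tensor_hom_bilinear_pure[OF bilinear_drinfeld])

text \<open>For pure \<open>W = p \<otimes> q\<close> the left-hand side is \<open>\<Sum> s(z\<^sub>1 q) z\<^sub>2 p = s(q) (\<Sum> s(z\<^sub>1) z\<^sub>2) p\<close>.\<close>

lemma drinfeld_flip_comult:
  assumes z: "z \<in> carrier A" and W: "W \<in> carrier (tensor2 k A)"
  shows "drinfeld (tensor_flip k A A (\<Delta> z) \<otimes>\<^bsub>tensor2 k A\<^esub> W) = \<epsilon> z \<odot>\<^bsub>A\<^esub> drinfeld W"
proof (rule AA.linear_map_ext[OF _ _ W, where M = A])
  show "linear_map k (tensor2 k A) A (\<lambda>W. drinfeld (tensor_flip k A A (\<Delta> z) \<otimes>\<^bsub>tensor2 k A\<^esub> W))"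
    "linear_map k (tensor2 k A) A (\<lambda>W. \<epsilon> z \<odot>\<^bsub>A\<^esub> drinfeld W)"
    by (intro linear_intros; simp add: z)+
  fix p q assume pq: "p \<in> carrier A" "q \<in> carrier A"
  have "drinfeld (tensor_flip k A A Z \<otimes>\<^bsub>tensor2 k A\<^esub> pure p q) = s q \<otimes>\<^bsub>A\<^esub> antipode_prod Z \<otimes>\<^bsub>A\<^esub> p"
    if Z: "Z \<in> carrier (tensor2 k A)" for Z
  proof (rule AA.linear_map_ext[OF _ _ Z, where M = A])
    show "linear_map k (tensor2 k A) A (\<lambda>Z. drinfeld (tensor_flip k A A Z \<otimes>\<^bsub>tensor2 k A\<^esub> pure p q))"
      "linear_map k (tensor2 k A) A (\<lambda>Z. s q \<otimes>\<^bsub>A\<^esub> antipode_prod Z \<otimes>\<^bsub>A\<^esub> p)"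
      by (intro linear_intros; simp add: pq)+
  qed (simp add: pq antipode_mult m_assoc)
  then show "drinfeld (tensor_flip k A A (\<Delta> z) \<otimes>\<^bsub>tensor2 k A\<^esub> pure p q) = \<epsilon> z \<odot>\<^bsub>A\<^esub> drinfeld (pure p q)"
    by (simp add: z pq antipode_prod_comult smult_mult_left smult_mult_right)
qed

text \<open>On pure tensors \<open>X = a \<otimes> b\<close> and \<open>Y = p \<otimes> q\<close> both sides are \<open>s(b) s(q) p s(a)\<close>.\<close>

lemma drinfeld_mult_antipode:
  assumes X: "X \<in> carrier (tensor2 k A)" and Y: "Y \<in> carrier (tensor2 k A)"
  shows "tensor_hom A (\<lambda>a b. b \<otimes>\<^bsub>A\<^esub> drinfeld Y \<otimes>\<^bsub>A\<^esub> a) (tensor_map k A A s s X) =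
    drinfeld (Y \<otimes>\<^bsub>tensor2 k A\<^esub> tensor_map k A A s (\<lambda>x. x) X)"
proof -
  have bil: "bilinear_map k A A A (\<lambda>a b. b \<otimes>\<^bsub>A\<^esub> u \<otimes>\<^bsub>A\<^esub> a)" if "u \<in> carrier A" for u
    by (intro bilinear_mapI linear_intros; simp add: that)
  show ?thesis
  proof (rule AA.linear_map_ext[OF _ _ X, where M = A])
    show "linear_map k (tensor2 k A) A
        (\<lambda>X. tensor_hom A (\<lambda>a b. b \<otimes>\<^bsub>A\<^esub> drinfeld Y \<otimes>\<^bsub>A\<^esub> a) (tensor_map k A A s s X))"
      "linear_map k (tensor2 k A) A (\<lambda>X. drinfeld (Y \<otimes>\<^bsub>tensor2 k A\<^esub> tensor_map k A A s (\<lambda>x. x) X))"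
      by (intro linear_intros bil; simp add: Y)+
    fix a b assume ab: "a \<in> carrier A" "b \<in> carrier A"
    have "s b \<otimes>\<^bsub>A\<^esub> drinfeld Y \<otimes>\<^bsub>A\<^esub> s a = drinfeld (Y \<otimes>\<^bsub>tensor2 k A\<^esub> pure (s a) b)"
    proof (rule AA.linear_map_ext[OF _ _ Y, where M = A])
      show "linear_map k (tensor2 k A) A (\<lambda>Y. s b \<otimes>\<^bsub>A\<^esub> drinfeld Y \<otimes>\<^bsub>A\<^esub> s a)"
        "linear_map k (tensor2 k A) A (\<lambda>Y. drinfeld (Y \<otimes>\<^bsub>tensor2 k A\<^esub> pure (s a) b))"
        by (intro linear_intros; simp add: ab)+
    qed (simp add: ab antipode_mult m_assoc)
    then show "tensor_hom A (\<lambda>a b. b \<otimes>\<^bsub>A\<^esub> drinfeld Y \<otimes>\<^bsub>A\<^esub> a) (tensor_map k A A s s (pure a b)) =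
        drinfeld (Y \<otimes>\<^bsub>tensor2 k A\<^esub> tensor_map k A A s (\<lambda>x. x) (pure a b))"
      by (simp add: ab Y AA.tensor_hom_bilinear_pure[OF bil])
  qed
qed

lemma antipode_bij:
  assumes u: "u \<in> Units A" and conj: "\<And>x. x \<in> carrier A \<Longrightarrow> s (s x) \<otimes>\<^bsub>A\<^esub> u = u \<otimes>\<^bsub>A\<^esub> x"
  shows "bij_betw s (carrier A) (carrier A)"
proof -
  have u': "u \<in> carrier A" "inv\<^bsub>A\<^esub> u \<in> carrier A"
    using u by auto
  have "inj_on s (carrier A)"
  proof (rule inj_onI)
    fix x y assume xy: "x \<in> carrier A" "y \<in> carrier A" and "s x = s y"
    then have "u \<otimes>\<^bsub>A\<^esub> x = u \<otimes>\<^bsub>A\<^esub> y"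
      using conj by metis
    then show "x = y"
      using u xy by simp
  qed
  moreover have "y \<in> s ` carrier A" if y: "y \<in> carrier A" for y
  proof -
    let ?x = "inv\<^bsub>A\<^esub> u \<otimes>\<^bsub>A\<^esub> y \<otimes>\<^bsub>A\<^esub> u"
    have "u \<otimes>\<^bsub>A\<^esub> ?x = u \<otimes>\<^bsub>A\<^esub> inv\<^bsub>A\<^esub> u \<otimes>\<^bsub>A\<^esub> y \<otimes>\<^bsub>A\<^esub> u"
      using u' y by (simp only: m_assoc m_closed)
    then have "s (s ?x) \<otimes>\<^bsub>A\<^esub> u = y \<otimes>\<^bsub>A\<^esub> u"
      using u u' y by (simp add: conj)
    then have "s (s ?x) \<otimes>\<^bsub>A\<^esub> (u \<otimes>\<^bsub>A\<^esub> inv\<^bsub>A\<^esub> u) = y \<otimes>\<^bsub>A\<^esub> (u \<otimes>\<^bsub>A\<^esub> inv\<^bsub>A\<^esub> u)"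
      using u' y by (simp flip: m_assoc del: Units_r_inv)
    then have "y = s (s ?x)"
      using u u' y by simp
    then show ?thesis
      using u' y by (intro image_eqI[of y s "s ?x"]) auto
  qed
  ultimately show ?thesis
    by (auto simp: bij_betw_def)
qed

end

context quasitriangular_hopf_algebra
begin

text \<open>The sum \<open>\<Sum> s\<^sup>2(x\<^sub>3) d(R(x\<^sub>1 \<otimes> x\<^sub>2))\<close>, where \<open>d(a \<otimes> b) = s(b)a\<close>, is evaluated in two ways. Since
  \<open>R \<Delta>(x\<^sub>1) = \<Delta>\<^sup>o\<^sup>p(x\<^sub>1) R\<close>, the first two components contract to a counit, which leaves \<open>s\<^sup>2(x)u\<close>. On
  the other hand the summand is \<open>s(x\<^sub>2 s(x\<^sub>3)) u x\<^sub>1\<close>, where the last two components contract, which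
  leaves \<open>ux\<close>.\<close>

lemma antipode_square_drinfeld:
  assumes x: "x \<in> carrier A"
  shows "s (s x) \<otimes>\<^bsub>A\<^esub> drinfeld R = drinfeld R \<otimes>\<^bsub>A\<^esub> x"
proof -
  define \<beta> where "\<beta> W a b c = s (s c) \<otimes>\<^bsub>A\<^esub> drinfeld (W \<otimes>\<^bsub>tensor2 k A\<^esub> pure a b)" for W a b c
  have \<beta>: "trilinear_map k A A A A (\<beta> R)"
    unfolding \<beta>_def by (intro trilinear_mapI linear_intros) simp_all
  have left: "tensor_hom A (\<lambda>a b. \<beta> R a b c) (\<Delta> z) = \<epsilon> z \<odot>\<^bsub>A\<^esub> (s (s c) \<otimes>\<^bsub>A\<^esub> drinfeld R)"
    if z: "z \<in> carrier A" and c: "c \<in> carrier A" for z c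
  proof -
    have "tensor_hom A (\<lambda>a b. \<beta> R a b c) (\<Delta> z) = s (s c) \<otimes>\<^bsub>A\<^esub> drinfeld (R \<otimes>\<^bsub>tensor2 k A\<^esub> \<Delta> z)"
      unfolding \<beta>_def
      by (rule AA.tensor_hom_pure_comp[where f = "\<lambda>W. s (s c) \<otimes>\<^bsub>A\<^esub> drinfeld (R \<otimes>\<^bsub>tensor2 k A\<^esub> W)"])
        (auto intro!: linear_intros simp: z c)
    also have "\<dots> = s (s c) \<otimes>\<^bsub>A\<^esub> drinfeld (tensor_flip k A A (\<Delta> z) \<otimes>\<^bsub>tensor2 k A\<^esub> R)"
      by (simp add: R_comult z)
    finally show ?thesis
      by (simp add: drinfeld_flip_comult smult_mult_right z c)
  qed
  have right: "tensor_hom A (\<beta> W a) (\<Delta> z) = \<epsilon> z \<odot>\<^bsub>A\<^esub> (drinfeld W \<otimes>\<^bsub>A\<^esub> a)"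
    if W: "W \<in> carrier (tensor2 k A)" and a: "a \<in> carrier A" and z: "z \<in> carrier A" for W a z
  proof (rule AA.linear_map_ext[OF _ _ W, where M = A and f = "\<lambda>W. tensor_hom A (\<beta> W a) (\<Delta> z)"])
    show "linear_map k (tensor2 k A) A (\<lambda>W. tensor_hom A (\<beta> W a) (\<Delta> z))"
      unfolding \<beta>_def by (intro linear_intros bilinear_mapI) (simp_all add: a z)
    show "linear_map k (tensor2 k A) A (\<lambda>W. \<epsilon> z \<odot>\<^bsub>A\<^esub> (drinfeld W \<otimes>\<^bsub>A\<^esub> a))"
      by (intro linear_intros) (simp_all add: a z)
    fix p q assume pq: "p \<in> carrier A" "q \<in> carrier A"
    let ?f = "\<lambda>w. s w \<otimes>\<^bsub>A\<^esub> (s q \<otimes>\<^bsub>A\<^esub> (p \<otimes>\<^bsub>A\<^esub> a))"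
    have f: "linear_map k A A ?f"
      by (intro linear_intros) (simp_all add: pq a)
    have "tensor_hom A (\<beta> (pure p q) a) (\<Delta> z) = tensor_hom A (\<lambda>b c. ?f (b \<otimes>\<^bsub>A\<^esub> s c)) (\<Delta> z)"
      by (rule AA.tensor_hom_cong)
        (auto intro!: bilinear_mapI linear_intros simp: \<beta>_def pq a z m_assoc antipode_mult)
    also have "\<dots> = \<epsilon> z \<odot>\<^bsub>A\<^esub> (drinfeld (pure p q) \<otimes>\<^bsub>A\<^esub> a)"
      by (simp add: antipode_right_hom[OF f] z pq a antipode_one m_assoc)
    finally show "tensor_hom A (\<beta> (pure p q) a) (\<Delta> z) = \<epsilon> z \<odot>\<^bsub>A\<^esub> (drinfeld (pure p q) \<otimes>\<^bsub>A\<^esub> a)" .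
  qed
  have "s (s x) \<otimes>\<^bsub>A\<^esub> drinfeld R = tensor_hom A (\<lambda>z c. \<epsilon> z \<odot>\<^bsub>A\<^esub> (s (s c) \<otimes>\<^bsub>A\<^esub> drinfeld R)) (\<Delta> x)"
    by (rule counit_left_hom[symmetric, where f = "\<lambda>c. s (s c) \<otimes>\<^bsub>A\<^esub> drinfeld R"])
      (auto intro!: linear_intros simp: x)
  also have "\<dots> = tensor_hom A (\<lambda>z c. tensor_hom A (\<lambda>a b. \<beta> R a b c) (\<Delta> z)) (\<Delta> x)"
    by (rule AA.tensor_hom_cong[symmetric]) (auto intro!: bilinear_mapI linear_intros simp: left x)
  also have "\<dots> = tensor_hom A (\<lambda>a z. tensor_hom A (\<beta> R a) (\<Delta> z)) (\<Delta> x)"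
    by (rule coassoc_hom) (simp_all add: \<beta> x)
  also have "\<dots> = tensor_hom A (\<lambda>a z. \<epsilon> z \<odot>\<^bsub>A\<^esub> (drinfeld R \<otimes>\<^bsub>A\<^esub> a)) (\<Delta> x)"
    by (rule AA.tensor_hom_cong) (auto intro!: bilinear_mapI linear_intros simp: right x)
  also have "\<dots> = drinfeld R \<otimes>\<^bsub>A\<^esub> x"
    by (rule counit_right_hom[where f = "\<lambda>a. drinfeld R \<otimes>\<^bsub>A\<^esub> a"]) (auto intro!: linear_intros simp: x)
  finally show ?thesis .
qed

text \<open>For \<open>R = \<Sum> a\<^sub>i \<otimes> b\<^sub>i\<close> the inverse of \<open>u\<close> is \<open>w = \<Sum> b\<^sub>i s\<^sup>2(a\<^sub>i)\<close>: as \<open>u b = s\<^sup>2(b) u\<close> and \<open>s \<otimes> s\<close> fixes \<open>R\<close>,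
  \<open>uw = \<Sum> s\<^sup>2(b\<^sub>i) u s\<^sup>2(a\<^sub>i) = \<Sum> s(b\<^sub>i) u s(a\<^sub>i)\<close>, and this is the image of \<open>R ((s \<otimes> 1)R) = 1\<close> under
  \<open>a \<otimes> b \<mapsto> s(b)a\<close>. A left inverse is then \<open>s\<^sup>2(w)\<close>, since \<open>s\<^sup>2(w)u = uw\<close>.\<close>

lemma drinfeld_Units: "drinfeld R \<in> Units A"
proof -
  let ?u = "drinfeld R"
  define w where "w = tensor_hom A (\<lambda>a b. b \<otimes>\<^bsub>A\<^esub> s (s a)) R"
  have bil: "bilinear_map k A A A (\<lambda>a b. b \<otimes>\<^bsub>A\<^esub> s (s a))" "bilinear_map k A A A (\<lambda>a b. b \<otimes>\<^bsub>A\<^esub> ?u \<otimes>\<^bsub>A\<^esub> a)"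
    by (intro bilinear_mapI linear_intros; simp)+
  have w: "w \<in> carrier A"
    unfolding w_def by (rule linear_map_closed[OF AA.linear_tensor_hom[OF bil(1) module_axioms] R_closed])
  have "?u \<otimes>\<^bsub>A\<^esub> tensor_hom A (\<lambda>a b. b \<otimes>\<^bsub>A\<^esub> s (s a)) X =
      tensor_hom A (\<lambda>a b. b \<otimes>\<^bsub>A\<^esub> ?u \<otimes>\<^bsub>A\<^esub> a) (tensor_map k A A s s (tensor_map k A A s s X))"
    if X: "X \<in> carrier (tensor2 k A)" for X
  proof (rule AA.linear_map_ext[OF _ _ X, where M = A])
    show "linear_map k (tensor2 k A) A (\<lambda>X. ?u \<otimes>\<^bsub>A\<^esub> tensor_hom A (\<lambda>a b. b \<otimes>\<^bsub>A\<^esub> s (s a)) X)"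
      "linear_map k (tensor2 k A) A
        (\<lambda>X. tensor_hom A (\<lambda>a b. b \<otimes>\<^bsub>A\<^esub> ?u \<otimes>\<^bsub>A\<^esub> a) (tensor_map k A A s s (tensor_map k A A s s X)))"
      by (intro linear_intros bil; simp)+
    fix a b assume ab: "a \<in> carrier A" "b \<in> carrier A"
    have "?u \<otimes>\<^bsub>A\<^esub> (b \<otimes>\<^bsub>A\<^esub> s (s a)) = s (s b) \<otimes>\<^bsub>A\<^esub> ?u \<otimes>\<^bsub>A\<^esub> s (s a)"
      using ab by (simp add: antipode_square_drinfeld m_assoc)
    then show "?u \<otimes>\<^bsub>A\<^esub> tensor_hom A (\<lambda>a b. b \<otimes>\<^bsub>A\<^esub> s (s a)) (pure a b) =
        tensor_hom A (\<lambda>a b. b \<otimes>\<^bsub>A\<^esub> ?u \<otimes>\<^bsub>A\<^esub> a) (tensor_map k A A s s (tensor_map k A A s s (pure a b)))"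
      using ab by (simp add: AA.tensor_hom_bilinear_pure[OF bil(1)] AA.tensor_hom_bilinear_pure[OF bil(2)])
  qed
  then have "?u \<otimes>\<^bsub>A\<^esub> w = tensor_hom A (\<lambda>a b. b \<otimes>\<^bsub>A\<^esub> ?u \<otimes>\<^bsub>A\<^esub> a) (tensor_map k A A s s R)"
    by (simp add: w_def antipode_antipode_R)
  also have "\<dots> = drinfeld (R \<otimes>\<^bsub>tensor2 k A\<^esub> inv\<^bsub>tensor2 k A\<^esub> R)"
    by (simp only: drinfeld_mult_antipode R_closed antipode_left_R)
  also have "\<dots> = \<one>\<^bsub>A\<^esub>"
    using R_invertible by (simp add: AA.one_tensor antipode_one)
  finally have uw: "?u \<otimes>\<^bsub>A\<^esub> w = \<one>\<^bsub>A\<^esub>" .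
  then have "s (s w) \<otimes>\<^bsub>A\<^esub> ?u = \<one>\<^bsub>A\<^esub>"
    by (simp add: antipode_square_drinfeld w)
  moreover from this have "s (s w) = w"
    using inv_unique[of "s (s w)" ?u w] uw w by simp
  ultimately show ?thesis
    using uw w by (auto simp: Units_def)
qed

lemma antipode_antiauto: "s \<in> algebra_antiauto k A"
  using antipode_bij[OF drinfeld_Units] antipode_square_drinfeld antipode_hom
  by (simp add: algebra_antiauto_def)

text \<open>By \<open>R\<Delta>(x) = \<Delta>\<^sup>o\<^sup>p(x)R\<close>, moving \<open>R\<^sub>1\<^sub>2\<close> past \<open>(\<Delta> \<otimes> 1)R = R\<^sub>1\<^sub>3R\<^sub>2\<^sub>3\<close> interchanges the first two tensor
  factors, which turns \<open>R\<^sub>1\<^sub>3R\<^sub>2\<^sub>3\<close> into \<open>R\<^sub>2\<^sub>3R\<^sub>1\<^sub>3\<close>.\<close>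

lemma yang_baxter_R: "yang_baxter k A R"
proof -
  let ?\<Delta>R = "tensor_map k (tensor2 k A) A \<Delta> id R"
  define flip12 where "flip12 = tensor_map k (tensor2 k A) A (tensor_flip k A A) (\<lambda>x. x)"
  have hom: "flip12 \<in> algebra_hom k (tensor3 k A) (tensor3 k A)"
    unfolding flip12_def by (rule tensor_map_algebra_hom) (simp_all add: flip_hom algebra_hom_ident)
  note lin = algebra_hom_linear[OF hom]
  have pure: "flip12 (pure3 X c) = pure3 (tensor_flip k A A X) c"
    if "X \<in> carrier (tensor2 k A)" "c \<in> carrier A" for X c
    using that by (simp add: flip12_def tensor_map_pure linear_flip linear_map_ident)
  have "place12 k A R \<otimes>\<^bsub>tensor3 k A\<^esub> ?\<Delta>R = flip12 ?\<Delta>R \<otimes>\<^bsub>tensor3 k A\<^esub> place12 k A R"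
    by (rule AA.linear_map_ext[OF _ _ R_closed, where M = "tensor3 k A"
          and f = "\<lambda>X. place12 k A R \<otimes>\<^bsub>tensor3 k A\<^esub> tensor_map k (tensor2 k A) A \<Delta> id X"
          and g = "\<lambda>X. flip12 (tensor_map k (tensor2 k A) A \<Delta> id X) \<otimes>\<^bsub>tensor3 k A\<^esub> place12 k A R"])
      ((intro linear_intros linear_comult_left linear_map_comp[OF lin])?; simp add: comult_left_pure pure;
        simp add: place12_def R_comult)+
  moreover have "flip12 (place13 k A X) = place23 k A X" "flip12 (place23 k A X) = place13 k A X"
    if X: "X \<in> carrier (tensor2 k A)" for X
    by (rule AA.linear_map_ext[OF _ _ X, where M = "tensor3 k A"];
        (intro linear_map_comp[OF lin] algebra_hom_linear place13_hom place23_hom)?; simp add: pure)+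
  ultimately show ?thesis
    by (simp add: yang_baxter_def R_comult_left algebra_hom_mult[OF hom] AAA.T.m_assoc)
qed

theorem quantum: "quantum_algebra k A R s"
proof
  let ?t = "inv_on A s"
  have t: "linear_map k A A ?t"
    using antiauto_inv[OF antipode_antiauto] algebra_hom_linear[of ?t k A "opposite A"]
    by (simp add: algebra_antiauto_def)
  have ts: "?t (s x) = x" if "x \<in> carrier A" for x
    using antipode_antiauto that by (auto simp: algebra_antiauto_def bij_betw_inv_into_left)
  have "tensor_map k A A (\<lambda>x. x) ?t R = tensor_map k A A (\<lambda>x. x) ?t (tensor_map k A A (\<lambda>x. x) s (inv\<^bsub>tensor2 k A\<^esub> R))"
    by (simp only: antipode_right_inv_R)
  also have "\<dots> = tensor_map k A A (\<lambda>x. x) (\<lambda>x. ?t (s x)) (inv\<^bsub>tensor2 k A\<^esub> R)"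
    by (rule tensor_map_comp[where A = A and B = A and C = A and D = A])
      (simp_all add: t linear_antipode linear_map_ident)
  also have "\<dots> = tensor_map k A A (\<lambda>x. x) (\<lambda>x. x) (inv\<^bsub>tensor2 k A\<^esub> R)"
    by (rule tensor_map_cong[where A = A and B = A]) (simp_all add: linear_map_ident ts)
  also have "\<dots> = inv\<^bsub>tensor2 k A\<^esub> R"
    by (rule tensor_map_ident) simp_all
  finally show "tensor_map k A A id ?t R = inv\<^bsub>tensor2 k A\<^esub> R"
    by (simp add: id_def)
  show "tensor_map k A A s id R = inv\<^bsub>tensor2 k A\<^esub> R"
    using antipode_left_R by (simp add: id_def)
qed (simp_all add: R_invertible yang_baxter_R antipode_antiauto antipode_antipode_R)

end


section \<open>The theorem for quantum algebras and ribbon Hopf algebras\<close>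

theorem mainTheorem3:
  fixes k :: "'k ring" and A :: "('k, 'a) module"
    and \<rho> :: "('a \<times> 'a \<Rightarrow>\<^sub>0 int) set" and s :: "'a \<Rightarrow> 'a"
  shows "(quantum_algebra k A \<rho> s \<longrightarrow>
            standard_oriented_quantum_algebra k A \<rho> id (inv_on A s \<circ> inv_on A s))
       \<and> (\<forall>\<Delta> \<epsilon> v. ribbon_hopf_algebra k A \<Delta> \<epsilon> s \<rho> v \<longrightarrow>
            quantum_algebra k A \<rho> s \<and>
            standard_oriented_quantum_algebra k A \<rho> id (inv_on A s \<circ> inv_on A s))"
proof (intro conjI allI impI)
  assume "quantum_algebra k A \<rho> s"
  then show "standard_oriented_quantum_algebra k A \<rho> id (inv_on A s \<circ> inv_on A s)"
    by (rule quantum_algebra.standard_oriented)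
next
  fix \<Delta> \<epsilon> v assume "ribbon_hopf_algebra k A \<Delta> \<epsilon> s \<rho> v"
  then have "quasitriangular_hopf_algebra k A \<Delta> \<epsilon> s \<rho>"
    by (rule ribbon_hopf_algebra.axioms(1))
  then show "quantum_algebra k A \<rho> s"
    by (rule quasitriangular_hopf_algebra.quantum)
  then show "standard_oriented_quantum_algebra k A \<rho> id (inv_on A s \<circ> inv_on A s)"
    by (rule quantum_algebra.standard_oriented)
qed

end
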